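(* Let $A_n$ be a chain cactus of length $n$ (its cycles may have different numbers of vertices), and let $O_n$ and $M_n$ be an ortho-chain cactus and a meta-chain cactus of length $n$ such that, for every $i=1,\dots,n$, the $i$-th cycles $C^{(i)}$ of $A_n$, $O_n$ and $M_n$ all have the same number of vertices. If $A_n$ is isomorphic neither to $O_n$ nor to $M_n$, then $$\Psi(O_n)<\Psi(A_n)<\Psi(M_n).$$
   Context: All graphs are finite and simple. $\Psi(G)$ denotes the total number of independent sets of $G$ (including the empty set). A cactus is a connected graph in which each edge lies in at most one cycle. A chain cactus is a cactus in which each block is a cycle containing at most two cut vertices and each cut vertex is contained in exactly two cycles; its length is the number of its cycles. In a chain cactus of length $n$ the cycles are denoted $C^{(1)},\dots,C^{(n)}$ in their order along the chain (consecutive cycles share one cut vertex). Internal cycles are $C^{(2)},\dots,C^{(n-1)}$; each contains exactly two cut vertices. An internal cycle is in $k$-position if its two cut vertices are at distance $k$ (in the cycle); $1$-position is called ortho-position and $2$-position is called meta-position. An ortho-chain (respectively meta-chain) cactus is a chain cactus all of whose internal cycles are in ortho-position (respectively meta-position). *)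

theory Defs
  imports "Graph_Theory.Graph_Theory"
begin

text \<open>
  Finite simple graphs are represented by the locale predicate \<^const>\<open>graph\<close>: finite symmetric
  digraphs without loops and parallel arcs. An undirected edge is thus a pair of antiparallel arcs.
\<close>

definition indep_sets :: "('a, 'b) pre_digraph \<Rightarrow> 'a set set" where
  "indep_sets G = {S. S \<subseteq> verts G \<and> (\<forall>u\<in>S. \<forall>v\<in>S. \<not> u \<rightarrow>\<^bsub>G\<^esub> v)}"

definition num_indep_sets :: "('a, 'b) pre_digraph \<Rightarrow> nat" where
  "num_indep_sets G = card (indep_sets G)"

text \<open>
  The bound on the length excludes the closed walks that traverse an edge back and forth,
  which \<^const>\<open>pre_digraph.cycle\<close> admits in a symmetric digraph.
\<close>

definition cycle_graph :: "('a, 'b) pre_digraph \<Rightarrow> bool" where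
  "cycle_graph C \<longleftrightarrow> graph C \<and>
     (\<exists>p. pre_digraph.cycle C p \<and> length p \<ge> 3 \<and>
          verts C = tail C ` set p \<and>
          arcs_ends C = arc_to_ends C ` set p \<union> (arc_to_ends C ` set p)\<inverse>)"

definition cycles :: "('a, 'b) pre_digraph \<Rightarrow> ('a, 'b) pre_digraph set" where
  "cycles G = {C. subgraph C G \<and> cycle_graph C}"

definition cut_vertex :: "('a, 'b) pre_digraph \<Rightarrow> 'a \<Rightarrow> bool" where
  "cut_vertex G v \<longleftrightarrow> v \<in> verts G \<and>
     (\<exists>x \<in> verts G - {v}. \<exists>y \<in> verts G - {v}.
        x \<rightarrow>\<^sup>*\<^bsub>G\<^esub> y \<and> \<not> x \<rightarrow>\<^sup>*\<^bsub>pre_digraph.del_vert G v\<^esub> y)"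

definition block :: "('a, 'b) pre_digraph \<Rightarrow> ('a, 'b) pre_digraph \<Rightarrow> bool" where
  "block G = pre_digraph.max_subgraph G
     (\<lambda>H. graph H \<and> connected H \<and> (\<nexists>v. cut_vertex H v))"

definition cactus :: "('a, 'b) pre_digraph \<Rightarrow> bool" where
  "cactus G \<longleftrightarrow> graph G \<and> connected G \<and>
     (\<forall>e \<in> arcs G. \<forall>C \<in> cycles G. \<forall>D \<in> cycles G. e \<in> arcs C \<and> e \<in> arcs D \<longrightarrow> C = D)"

definition chain_cactus :: "('a, 'b) pre_digraph \<Rightarrow> bool" where
  "chain_cactus G \<longleftrightarrow> cactus G \<and>
     (\<forall>B. block G B \<longrightarrow> cycle_graph B \<and> card {v \<in> verts B. cut_vertex G v} \<le> 2) \<and>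
     (\<forall>v. cut_vertex G v \<longrightarrow> card {C \<in> cycles G. v \<in> verts C} = 2)"

text \<open>
  \<open>chain_order G Cs\<close> states that \<open>Cs\<close> lists the cycles of \<open>G\<close> in their order along the chain.
  In a chain cactus this order is unique up to reversal. The \<open>i\<close>-th cycle is \<open>Cs ! (i - 1)\<close>.
\<close>

definition chain_order :: "('a, 'b) pre_digraph \<Rightarrow> ('a, 'b) pre_digraph list \<Rightarrow> bool" where
  "chain_order G Cs \<longleftrightarrow> distinct Cs \<and> set Cs = cycles G \<and>
     (\<forall>i. Suc i < length Cs \<longrightarrow>
        (\<exists>v. cut_vertex G v \<and> verts (Cs ! i) \<inter> verts (Cs ! Suc i) = {v}))"

text \<open>The distance in \<open>C\<close> is the library's weighted distance with all arcs of weight one.\<close>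

definition in_position :: "nat \<Rightarrow> ('a, 'b) pre_digraph \<Rightarrow> ('a, 'b) pre_digraph \<Rightarrow> bool" where
  "in_position k G C \<longleftrightarrow>
     (\<exists>u v. u \<noteq> v \<and> {w \<in> verts C. cut_vertex G w} = {u, v} \<and>
            wf_digraph.\<mu> C (\<lambda>_. 1) u v = ereal (real k))"

definition internal_in_position ::
  "nat \<Rightarrow> ('a, 'b) pre_digraph \<Rightarrow> ('a, 'b) pre_digraph list \<Rightarrow> bool" where
  "internal_in_position k G Cs \<longleftrightarrow>
     (\<forall>i. 0 < i \<and> Suc i < length Cs \<longrightarrow> in_position k G (Cs ! i))"

definition ortho_chain :: "('a, 'b) pre_digraph \<Rightarrow> ('a, 'b) pre_digraph list \<Rightarrow> bool" where
  "ortho_chain G Cs \<longleftrightarrow>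
     chain_cactus G \<and> chain_order G Cs \<and> internal_in_position 1 G Cs"

definition meta_chain :: "('a, 'b) pre_digraph \<Rightarrow> ('a, 'b) pre_digraph list \<Rightarrow> bool" where
  "meta_chain G Cs \<longleftrightarrow>
     chain_cactus G \<and> chain_order G Cs \<and> internal_in_position 2 G Cs"

end

theory Submission
  imports Defs "HOL-Number_Theory.Fib"
begin

text \<open>
  Counting independent sets along the chain is a product of symmetric transfer matrices, one per
  cycle, indexed by whether the two attaching vertices belong to the set. For a cycle of \<open>m\<close> vertices
  in \<open>k\<close>-position the matrix has Fibonacci entries and equals \<open>T + c * ((1, -1), (-1, 1))\<close>, where \<open>T\<close>
  depends only on \<open>m\<close> and \<open>c = fib (k - 1) * fib (m - k - 1)\<close> counts the sets containing both
  attaching vertices. Changing one position therefore changes the count by the difference of the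
  values of \<open>c\<close> times two positive factors. On \<open>1 \<le> k \<le> m / 2\<close> the number \<open>c\<close> is minimal only for
  \<open>k = 1\<close> and maximal only for \<open>k = 2\<close>, and equal positions give isomorphic chains.

  The chain structure follows from the cut vertices: a vertex shared by two consecutive cycles
  separates \<open>G\<close>, while every cycle is a block and stays connected after deletion of a vertex, so
  the cycles before and after the shared vertex have no other vertex in common.
\<close>

section \<open>Transfer matrices\<close>

text \<open>Bare vertex and edge sets allow pieces, such as a path inside a cycle, to be united
  without building digraph records.\<close>

definition indep :: "'a set \<Rightarrow> ('a \<times> 'a) set \<Rightarrow> 'a set set" where
  "indep V E = {S. S \<subseteq> V \<and> (\<forall>u\<in>S. \<forall>v\<in>S. (u, v) \<notin> E)}"

lemma indep_sets_eq: "indep_sets G = indep (verts G) (arcs_ends G)"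
  by (simp add: indep_sets_def indep_def)

lemma finite_indep: "finite V \<Longrightarrow> finite (indep V E)"
  by (rule finite_subset[of _ "Pow V"]) (auto simp: indep_def)

text \<open>Edges stay inside their piece, so a set is independent in the union exactly when both of
  its traces are independent. Once the trace \<open>T\<close> on the common vertices is fixed, the
  two traces can be chosen freely of each other.\<close>

lemma card_indep_glue:
  assumes E: "E1 \<subseteq> V1 \<times> V1" "E2 \<subseteq> V2 \<times> V2"
  shows "card {S \<in> indep (V1 \<union> V2) (E1 \<union> E2). S \<inter> (V1 \<inter> V2) = T \<and> P (S \<inter> V1) \<and> Q (S \<inter> V2)} =
    card {S \<in> indep V1 E1. S \<inter> (V1 \<inter> V2) = T \<and> P S} * card {S \<in> indep V2 E2. S \<inter> (V1 \<inter> V2) = T \<and> Q S}"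
    (is "card ?L = card ?A * card ?B")
proof -
  have ss: "(S \<union> S') \<inter> V1 = S" "(S \<union> S') \<inter> V2 = S'" if "S \<in> ?A" "S' \<in> ?B" for S S'
    using that by (auto simp: indep_def)
  have sep: "(u, v) \<in> E1 \<longrightarrow> u \<in> V1 \<and> v \<in> V1" "(u, v) \<in> E2 \<longrightarrow> u \<in> V2 \<and> v \<in> V2" for u v
    using E by auto
  have "bij_betw (\<lambda>(S, S'). S \<union> S') (?A \<times> ?B) ?L"
  proof (rule bij_betw_byWitness[where f' = "\<lambda>S. (S \<inter> V1, S \<inter> V2)"])
    show "\<forall>a\<in>?A \<times> ?B. (\<lambda>S. (S \<inter> V1, S \<inter> V2)) ((\<lambda>(S, S'). S \<union> S') a) = a"
      using ss by auto
    show "\<forall>S\<in>?L. (\<lambda>(S, S'). S \<union> S') (S \<inter> V1, S \<inter> V2) = S"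
      by (auto simp: indep_def)
    show "(\<lambda>(S, S'). S \<union> S') ` (?A \<times> ?B) \<subseteq> ?L"
    proof clarify
      fix S S' assume S: "S \<in> indep V1 E1" "P S" "S' \<in> indep V2 E2"
        "S' \<inter> (V1 \<inter> V2) = S \<inter> (V1 \<inter> V2)" "Q S'" "T = S \<inter> (V1 \<inter> V2)"
      have eq: "(S \<union> S') \<inter> V1 = S" "(S \<union> S') \<inter> V2 = S'"
        using S by (auto simp: indep_def)
      have "(u, v) \<notin> E1 \<union> E2" if uv: "u \<in> S \<union> S'" "v \<in> S \<union> S'" for u v
      proof
        assume "(u, v) \<in> E1 \<union> E2"
        then show False
        proof
          assume e: "(u, v) \<in> E1"
          then have "u \<in> (S \<union> S') \<inter> V1" "v \<in> (S \<union> S') \<inter> V1" using sep uv by auto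
          then show False using e S(1) unfolding eq by (auto simp: indep_def)
        next
          assume e: "(u, v) \<in> E2"
          then have "u \<in> (S \<union> S') \<inter> V2" "v \<in> (S \<union> S') \<inter> V2" using sep uv by auto
          then show False using e S(3) unfolding eq by (auto simp: indep_def)
        qed
      qed
      then have "S \<union> S' \<in> indep (V1 \<union> V2) (E1 \<union> E2)"
        using S(1,3) by (auto simp: indep_def)
      then show "S \<union> S' \<in> indep (V1 \<union> V2) (E1 \<union> E2) \<and> (S \<union> S') \<inter> (V1 \<inter> V2) = S \<inter> (V1 \<inter> V2) \<and>
          P ((S \<union> S') \<inter> V1) \<and> Q ((S \<union> S') \<inter> V2)"
        using eq S by auto
    qed
    show "(\<lambda>S. (S \<inter> V1, S \<inter> V2)) ` ?L \<subseteq> ?A \<times> ?B"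
      by (auto simp: indep_def)
  qed
  then have "card ?L = card (?A \<times> ?B)" by (simp add: bij_betw_same_card)
  then show ?thesis by (simp add: card_cartesian_product)
qed

text \<open>A single common vertex is either in the set or not, and each state is counted by the
  gluing lemma. \<open>P\<close> and \<open>Q\<close> carry the conditions at the far ends, so that
  the sum over \<open>s\<close> has the shape of a matrix product.\<close>

lemma card_indep_series:
  assumes fin: "finite V1" "finite V2"
    and E: "E1 \<subseteq> V1 \<times> V1" "E2 \<subseteq> V2 \<times> V2" and z: "V1 \<inter> V2 = {z}"
  shows "card {S \<in> indep (V1 \<union> V2) (E1 \<union> E2). P (S \<inter> V1) \<and> Q (S \<inter> V2)} =
    (\<Sum>s\<in>UNIV. card {S \<in> indep V1 E1. (z \<in> S) = s \<and> P S} * card {S \<in> indep V2 E2. (z \<in> S) = s \<and> Q S})"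
    (is "card ?L = _")
proof -
  have meet: "S \<inter> {z} = (if s then {z} else {}) \<longleftrightarrow> (z \<in> S) = s" for S s by auto
  define L where "L s = {S \<in> indep (V1 \<union> V2) (E1 \<union> E2).
    S \<inter> (V1 \<inter> V2) = (if s then {z} else {}) \<and> P (S \<inter> V1) \<and> Q (S \<inter> V2)}" for s
  have "?L = L True \<union> L False" "L True \<inter> L False = {}"
    unfolding L_def z by auto
  moreover have "finite (L s)" for s
    using finite_indep[of "V1 \<union> V2"] fin by (simp add: L_def)
  ultimately have "card ?L = card (L True) + card (L False)"
    by (simp add: card_Un_disjoint)
  moreover have "card (L s) = card {S \<in> indep V1 E1. (z \<in> S) = s \<and> P S} * card {S \<in> indep V2 E2. (z \<in> S) = s \<and> Q S}" for s
    using card_indep_glue[OF E, of "if s then {z} else {}" P Q] unfolding L_def z meet .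
  ultimately show ?thesis
    by (simp only: UNIV_bool) simp
qed

text \<open>For fixed \<open>u\<close> and \<open>w\<close> this is the transfer matrix of the
  piece, with rows \<open>x\<close> and columns \<open>y\<close> in \<open>bool\<close>.\<close>

definition end_count :: "'a set \<Rightarrow> ('a \<times> 'a) set \<Rightarrow> 'a \<Rightarrow> bool \<Rightarrow> 'a \<Rightarrow> bool \<Rightarrow> nat" where
  "end_count V E u x w y = card {S \<in> indep V E. (u \<in> S) = x \<and> (w \<in> S) = y}"

lemma end_count_swap: "end_count V E u x w y = end_count V E w y u x"
  unfolding end_count_def by (rule arg_cong[of _ _ card]) blast

lemma end_count_series:
  assumes fin: "finite V1" "finite V2"
    and E: "E1 \<subseteq> V1 \<times> V1" "E2 \<subseteq> V2 \<times> V2" and z: "V1 \<inter> V2 = {z}"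
    and u: "u \<in> V1" and w: "w \<in> V2"
  shows "end_count (V1 \<union> V2) (E1 \<union> E2) u x w y =
    (\<Sum>s\<in>UNIV. end_count V1 E1 u x z s * end_count V2 E2 z s w y)"
  using card_indep_series[OF fin E z, of "\<lambda>S. (u \<in> S) = x" "\<lambda>S. (w \<in> S) = y"] u w
  by (simp add: end_count_def conj_ac)

text \<open>The states of both common vertices are already prescribed by \<open>x\<close> and
  \<open>y\<close>, so the matrices are multiplied entrywise.\<close>

lemma end_count_parallel:
  assumes E: "E1 \<subseteq> V1 \<times> V1" "E2 \<subseteq> V2 \<times> V2" and uw: "V1 \<inter> V2 = {u, w}" "u \<noteq> w"
  shows "end_count (V1 \<union> V2) (E1 \<union> E2) u x w y = end_count V1 E1 u x w y * end_count V2 E2 u x w y"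
proof -
  have "S \<inter> {u, w} = (if x then {u} else {}) \<union> (if y then {w} else {}) \<longleftrightarrow> (u \<in> S) = x \<and> (w \<in> S) = y" for S
    using uw(2) by (cases x; cases y) auto
  then show ?thesis
    using card_indep_glue[OF E, of "(if x then {u} else {}) \<union> (if y then {w} else {})" "\<lambda>_. True" "\<lambda>_. True"]
    unfolding uw(1) end_count_def by simp
qed

section \<open>Transfer matrices of paths and cycles\<close>

text \<open>\<open>g\<close> need not be injective: with \<open>g m = g 0\<close> the same
  definition describes a closed cycle.\<close>

definition walk_edges :: "(nat \<Rightarrow> 'a) \<Rightarrow> nat \<Rightarrow> nat \<Rightarrow> ('a \<times> 'a) set" where
  "walk_edges g a b = (\<Union>i\<in>{a..<b}. {(g i, g (Suc i)), (g (Suc i), g i)})"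

lemma walk_edges_sub: "walk_edges g a b \<subseteq> g ` {a..b} \<times> g ` {a..b}"
  by (auto simp: walk_edges_def)

lemma walk_edges_Un: "a \<le> b \<Longrightarrow> b \<le> c \<Longrightarrow> walk_edges g a c = walk_edges g a b \<union> walk_edges g b c"
  unfolding walk_edges_def by (subst ivl_disj_un(17)[symmetric, of a b c]) auto

lemma end_count_edge:
  assumes "p \<noteq> q"
  shows "end_count {p, q} {(p, q), (q, p)} p x q y = (if x \<and> y then 0 else 1)"
proof -
  have "{S \<in> indep {p, q} {(p, q), (q, p)}. (p \<in> S) = x \<and> (q \<in> S) = y} =
    (if x \<and> y then {} else {(if x then {p} else {}) \<union> (if y then {q} else {})})"
    using assms by (cases x; cases y) (auto simp: indep_def)
  then show ?thesis by (simp add: end_count_def)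
qed

text \<open>Only used for \<open>d > 0\<close>, because \<open>d - 1\<close> is truncated.\<close>
definition path_count :: "nat \<Rightarrow> bool \<Rightarrow> bool \<Rightarrow> nat" where
  "path_count d x y = (if x \<and> y then fib (d - 1) else if x \<or> y then fib d else fib (Suc d))"

text \<open>Appending an edge multiplies the matrix by ((1, 1), (1, 0)), with the state outside the
  set first; the powers of this matrix have Fibonacci entries.\<close>

lemma end_count_path:
  assumes "inj_on g {a..a + Suc d}"
  shows "end_count (g ` {a..a + Suc d}) (walk_edges g a (a + Suc d)) (g a) x (g (a + Suc d)) y = path_count (Suc d) x y"
  using assms
proof (induction d arbitrary: y)
  case 0
  have *: "g ` {a..Suc a} = {g a, g (Suc a)}" "walk_edges g a (Suc a) = {(g a, g (Suc a)), (g (Suc a), g a)}"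
    by (auto simp: walk_edges_def atLeastAtMostSuc_conv)
  have "g a \<noteq> g (Suc a)"
    using 0 by (auto dest: inj_onD[of g _ a "Suc a"])
  then show ?case
    by (simp add: * end_count_edge path_count_def)
next
  case (Suc d)
  let ?b = "a + Suc d"
  have ne: "g i \<noteq> g (Suc ?b)" if "i \<in> {a..?b}" for i
    using Suc.prems that by (auto dest: inj_onD[of g _ i "Suc ?b"])
  have V: "g ` {a..a + Suc (Suc d)} = g ` {a..?b} \<union> {g ?b, g (Suc ?b)}"
    by (auto simp: atLeastAtMostSuc_conv)
  have E: "walk_edges g a (a + Suc (Suc d)) = walk_edges g a ?b \<union> {(g ?b, g (Suc ?b)), (g (Suc ?b), g ?b)}"
    by (auto simp: walk_edges_def atLeastLessThanSuc)
  have "g ` {a..?b} \<inter> {g ?b, g (Suc ?b)} = {g ?b}"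
    using ne by auto
  moreover have "inj_on g {a..?b}"
    using Suc.prems by (rule inj_on_subset) auto
  moreover have "end_count {g ?b, g (Suc ?b)} {(g ?b, g (Suc ?b)), (g (Suc ?b), g ?b)} (g ?b) s (g (Suc ?b)) y = (if s \<and> y then 0 else 1)" for s
    using ne[of ?b] by (intro end_count_edge) auto
  ultimately have "end_count (g ` {a..?b} \<union> {g ?b, g (Suc ?b)}) (walk_edges g a ?b \<union> {(g ?b, g (Suc ?b)), (g (Suc ?b), g ?b)}) (g a) x (g (Suc ?b)) y
    = (\<Sum>s\<in>UNIV. path_count (Suc d) x s * (if s \<and> y then 0 else 1))"
    using Suc.IH walk_edges_sub[of g a ?b] by (subst end_count_series[of _ _ _ _ "g ?b"]) simp_all
  also have "\<dots> = path_count (Suc (Suc d)) x y"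
    by (cases d) (auto simp: UNIV_bool path_count_def)
  finally show ?case unfolding V E by simp
qed

definition cyclic :: "nat \<Rightarrow> (nat \<Rightarrow> 'a) \<Rightarrow> 'a set \<Rightarrow> ('a \<times> 'a) set \<Rightarrow> bool" where
  "cyclic m g V E \<longleftrightarrow> 3 \<le> m \<and> inj_on g {..<m} \<and> g m = g 0 \<and> V = g ` {..<m} \<and> E = walk_edges g 0 m"

lemma cyclic_edges_sub: "cyclic m g V E \<Longrightarrow> E \<subseteq> V \<times> V"
proof -
  assume c: "cyclic m g V E"
  have "g i \<in> V" if "i \<le> m" for i
    using c that by (cases "i = m") (auto simp: cyclic_def)
  then show "E \<subseteq> V \<times> V" using c by (auto simp: cyclic_def walk_edges_def)
qed

text \<open>The poles \<open>g 0\<close> and \<open>g k\<close> cut the cycle into paths with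
  \<open>k\<close> and \<open>m - k\<close> edges, which are glued in parallel.\<close>

lemma end_count_cyclic:
  assumes c: "cyclic m g V E" and k: "0 < k" "k < m"
  shows "end_count V E (g 0) x (g k) y = path_count k x y * path_count (m - k) x y"
proof -
  have inj: "inj_on g {..<m}" and m: "g m = g 0" and V: "V = g ` {..<m}" and E: "E = walk_edges g 0 m"
    using c by (auto simp: cyclic_def)
  have gi: "g i \<noteq> g j" if "i < j" "j < m" for i j
    using inj that by (auto dest: inj_onD[of g _ i j])
  have "V = g ` {0..k} \<union> g ` {k..m}"
  proof -
    have "{..<m} \<union> {m} = {0..k} \<union> {k..m}" using k by auto
    then have "g ` {..<m} \<union> {g m} = g ` {0..k} \<union> g ` {k..m}" by (metis image_Un image_empty image_insert)
    then show ?thesis using m V k by auto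
  qed
  moreover have "E = walk_edges g 0 k \<union> walk_edges g k m"
    using E k walk_edges_Un[of 0 k m g] by simp
  moreover have "g ` {0..k} \<inter> g ` {k..m} = {g 0, g k}"
  proof -
    have "g i = g 0 \<or> g i = g k" if "i \<le> k" "k \<le> j" "j \<le> m" "g i = g j" for i j
      using gi[of i j] that m by (cases "j = m"; cases "i = j") auto
    then have "g ` {0..k} \<inter> g ` {k..m} \<subseteq> {g 0, g k}" by fastforce
    \<comment> \<open>The vertex \<open>g 0\<close> lies on the second path under its other index
      \<open>m\<close>.\<close>
    moreover have "g 0 \<in> g ` {k..m}" using m k by (metis atLeastAtMost_iff imageI le_refl less_imp_le)
    moreover have "g 0 \<in> g ` {0..k}" "g k \<in> g ` {0..k}" "g k \<in> g ` {k..m}" using k by auto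
    ultimately show ?thesis by blast
  qed
  moreover have "g 0 \<noteq> g k" using gi[of 0 k] k by simp
  ultimately have "end_count V E (g 0) x (g k) y =
      end_count (g ` {0..k}) (walk_edges g 0 k) (g 0) x (g k) y * end_count (g ` {k..m}) (walk_edges g k m) (g 0) x (g k) y"
    using walk_edges_sub[of g] by (simp add: end_count_parallel)
  also have "end_count (g ` {0..k}) (walk_edges g 0 k) (g 0) x (g k) y = path_count k x y"
  proof -
    have "inj_on g {0..k}" using k by (intro inj_on_subset[OF inj]) auto
    then show ?thesis using end_count_path[of g 0 "k - 1" x y] k by simp
  qed
  also have "end_count (g ` {k..m}) (walk_edges g k m) (g 0) x (g k) y = path_count (m - k) x y"
  proof -
    \<comment> \<open>The index \<open>m\<close> denotes \<open>g 0\<close>, whose other index 0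
      lies below \<open>k\<close>.\<close>
    have "g i \<noteq> g j" if "k \<le> i" "i < j" "j \<le> m" for i j
      using gi[of i j] gi[of 0 i] that k m by (cases "j = m") auto
    then have "inj_on g {k..k + Suc (m - k - 1)}"
      using k by (intro linorder_inj_onI) auto
    moreover have "Suc (m - k - 1) = m - k" "k + (m - k) = m" using k by auto
    \<comment> \<open>A path is enumerated from its smaller index, here from \<open>g k\<close>, so
      the two states are exchanged; \<open>path_count\<close> is symmetric in them.\<close>
    ultimately have "end_count (g ` {k..m}) (walk_edges g k m) (g k) y (g m) x = path_count (m - k) y x"
      using end_count_path[of g k "m - k - 1" y x] by metis
    then show ?thesis by (simp add: m end_count_swap[of _ _ "g 0"] path_count_def disj_commute conj_commute)
  qed
  finally show ?thesis .
qed

section \<open>The chain as a matrix product\<close>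

text \<open>The row vector \<open>(p, q)\<close> stands for the numbers of sets avoiding and
  containing the current joint; the matrices of the cycles are applied to it from left to right.
  Integers are used because the vector (1, -1) is inserted later.\<close>

fun chain_sum :: "(nat \<times> nat) list \<Rightarrow> int \<Rightarrow> int \<Rightarrow> int" where
  "chain_sum [] p q = p + q"
| "chain_sum ((m, k) # xs) p q = chain_sum xs
     (p * int (fib (Suc k) * fib (Suc (m - k))) + q * int (fib k * fib (m - k)))
     (p * int (fib k * fib (m - k)) + q * int (fib (k - 1) * fib (m - k - 1)))"

text \<open>The enumeration of a cycle starts at the joint with the preceding cycle and reaches the
  next joint at index \<open>k i\<close>. The first pole of the first cycle and the second pole of
  the last one are free, so that every cycle has two poles.\<close>

definition cycle_chain :: "nat \<Rightarrow> (nat \<Rightarrow> nat) \<Rightarrow> (nat \<Rightarrow> nat) \<Rightarrow> (nat \<Rightarrow> nat \<Rightarrow> 'a) \<Rightarrow>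
    (nat \<Rightarrow> 'a set) \<Rightarrow> (nat \<Rightarrow> ('a \<times> 'a) set) \<Rightarrow> bool" where
  "cycle_chain n m k g V E \<longleftrightarrow>
     (\<forall>i<n. cyclic (m i) (g i) (V i) (E i) \<and> 0 < k i \<and> k i < m i) \<and>
     (\<forall>i. Suc i < n \<longrightarrow> g i (k i) = g (Suc i) 0) \<and>
     (\<forall>i j. i < j \<and> j < n \<longrightarrow> V i \<inter> V j = (if j = Suc i then {g j 0} else {}))"

lemma card_indep_cycle_chain:
  assumes c: "cycle_chain n m k g V E" and n: "0 < n"
  shows "int (card (indep (\<Union>i<n. V i) (\<Union>i<n. E i))) = chain_sum (map (\<lambda>i. (m i, k i)) [0..<n]) 1 1"
proof -
  \<comment> \<open>A joint is named by the cycle before it, so that \<open>u n\<close> is the last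
    pole although there is no cycle \<open>n\<close>.\<close>
  define u where "u j = (if j = 0 then g 0 0 else g (j - 1) (k (j - 1)))" for j
  \<comment> \<open>The inserted vertex is for \<open>j = 0\<close>: the count starts from a single
    vertex without edges, that is from the vector (1, 1).\<close>
  define W where "W j = insert (u 0) (\<Union>i<j. V i)" for j
  define F where "F j = (\<Union>i<j. E i)" for j
  define N where "N j y = card {S \<in> indep (W j) (F j). (u j \<in> S) = y}" for j y
  have cyc: "cyclic (m i) (g i) (V i) (E i)" "0 < k i" "k i < m i" if "i < n" for i
    using c that by (auto simp: cycle_chain_def)
  have u: "u j = g j 0" if "j < n" for j
    using c that by (cases j) (auto simp: u_def cycle_chain_def)
  have gV: "g i 0 \<in> V i" "g i (k i) \<in> V i" if "i < n" for i
    using cyc[OF that] by (auto simp: cyclic_def)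
  have finV: "finite (V i)" if "i < n" for i
    using cyc[OF that] by (auto simp: cyclic_def)
  have FW: "F j \<subseteq> W j \<times> W j" if "j \<le> n" for j
  proof -
    have "E i \<subseteq> W j \<times> W j" if "i < j" for i
    proof -
      have "V i \<subseteq> W j" using that by (auto simp: W_def)
      then show ?thesis using cyclic_edges_sub[OF cyc(1), of i] that \<open>j \<le> n\<close> by fastforce
    qed
    then show ?thesis unfolding F_def by blast
  qed
  have finW: "finite (W j)" if "j \<le> n" for j
    using that finV by (auto simp: W_def)
  have meet: "W j \<inter> V j = {u j}" if "j < n" for j
  proof (cases j)
    case 0
    then show ?thesis using gV[of 0] u[of 0] that by (auto simp: W_def)
  next
    case (Suc j')
    have "V i \<inter> V j \<subseteq> {g j 0}" if "i < j" for i
      using c \<open>j < n\<close> that unfolding cycle_chain_def by auto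
    moreover have "u 0 \<in> V 0" using gV u n by auto
    moreover have "V j' \<inter> V j = {g j 0}"
      using c \<open>j < n\<close> Suc unfolding cycle_chain_def by auto
    moreover have W: "W j = (\<Union>i<j. V i)" "V j' \<subseteq> W j"
      using \<open>u 0 \<in> V 0\<close> Suc by (auto simp: W_def)
    ultimately have "W j \<inter> V j \<subseteq> {g j 0}" "g j 0 \<in> W j \<inter> V j"
      by auto
    then show ?thesis unfolding u[OF that] by blast
  qed
  have uS: "u (Suc j) = g j (k j)" for j by (simp add: u_def)
  have step: "N (Suc j) y = (\<Sum>s\<in>UNIV. N j s * (path_count (k j) s y * path_count (m j - k j) s y))" if j: "j < n" for j y
  proof -
    have WF: "W (Suc j) = W j \<union> V j" "F (Suc j) = F j \<union> E j" by (auto simp: W_def F_def lessThan_Suc)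
    have part: "card {S \<in> indep (V j) (E j). (u j \<in> S) = s \<and> (u (Suc j) \<in> S) = y} = path_count (k j) s y * path_count (m j - k j) s y" for s
      using end_count_cyclic[OF cyc[OF j], of s y] unfolding end_count_def u[OF j] uS by simp
    have "N (Suc j) y = card {S \<in> indep (W j \<union> V j) (F j \<union> E j). True \<and> (u (Suc j) \<in> S \<inter> V j) = y}"
      using gV(2)[OF j] unfolding N_def WF uS by simp
    also have "\<dots> = (\<Sum>s\<in>UNIV. card {S \<in> indep (W j) (F j). (u j \<in> S) = s \<and> True} *
        card {S \<in> indep (V j) (E j). (u j \<in> S) = s \<and> (u (Suc j) \<in> S) = y})"
      using j by (intro card_indep_series finW finV FW cyclic_edges_sub[OF cyc(1)] meet) auto
    finally show ?thesis unfolding part N_def by simp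
  qed
  \<comment> \<open>Invariant: \<open>N j\<close> is the vector after the first \<open>j\<close>
    cycles, and the remaining cycles are still to be applied.\<close>
  have "chain_sum (map (\<lambda>i. (m i, k i)) [0..<n]) 1 1 =
      chain_sum (map (\<lambda>i. (m i, k i)) [j..<n]) (int (N j False)) (int (N j True))" if "j \<le> n" for j
    using that
  proof (induction j)
    case 0
    have "{S \<in> indep {u 0} {}. u 0 \<notin> S} = {{}}" "{S \<in> indep {u 0} {}. u 0 \<in> S} = {{u 0}}"
      by (auto simp: indep_def)
    then show ?case by (simp add: N_def W_def F_def)
  next
    case (Suc j)
    then have "[j..<n] = j # [Suc j..<n]" by (simp add: upt_conv_Cons)
    then show ?case
      using Suc by (simp add: step UNIV_bool path_count_def algebra_simps)
  qed
  from this[of n] have "chain_sum (map (\<lambda>i. (m i, k i)) [0..<n]) 1 1 = int (N n False + N n True)" by simp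
  also have "N n False + N n True = card (indep (W n) (F n))"
  proof -
    have "indep (W n) (F n) = {S \<in> indep (W n) (F n). (u n \<in> S) = False} \<union> {S \<in> indep (W n) (F n). (u n \<in> S) = True}" by auto
    moreover have "finite (indep (W n) (F n))" using finW by (simp add: finite_indep)
    ultimately show ?thesis unfolding N_def by (subst card_Un_disjoint[symmetric]) auto
  qed
  also have "W n = (\<Union>i<n. V i)"
    using gV[of 0] n u[of 0] by (auto simp: W_def)
  finally show ?thesis by (simp add: F_def)
qed

section \<open>Monotonicity in the positions\<close>

definition both_ends :: "nat \<Rightarrow> nat \<Rightarrow> nat" where
  "both_ends m k = fib (k - 1) * fib (m - k - 1)"

text \<open>A row sum of the matrix counts the sets with the state of one pole fixed, which cannot
  depend on \<open>k\<close>: \<open>fib (m - 1)\<close> sets contain the pole and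
  \<open>fib (Suc m)\<close> avoid it. Formally this is the addition formula for Fibonacci
  numbers.\<close>

lemma transfer_entries:
  assumes "0 < k" "k < m"
  shows "fib (Suc k) * fib (Suc (m - k)) = fib m + both_ends m k"
    and "fib k * fib (m - k) + both_ends m k = fib (m - 1)"
proof -
  obtain x where x: "k = Suc x" using assms by (cases k) auto
  obtain y where y: "m - k = Suc y" using assms by (cases "m - k") auto
  have m: "m = Suc (Suc (x + y))" using x y assms by simp
  show "fib k * fib (m - k) + both_ends m k = fib (m - 1)"
    unfolding both_ends_def y using m x fib_add[of x y] by simp
  show "fib (Suc k) * fib (Suc (m - k)) = fib m + both_ends m k"
    unfolding both_ends_def y using m x fib_add[of "Suc x" y] fib_add[of x y] by (simp add: algebra_simps)
qed

lemma both_ends_one: "both_ends m 1 = 0"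
  by (simp add: both_ends_def)

lemma both_ends_two: "both_ends m 2 = fib (m - 3)"
  by (simp add: both_ends_def numeral_3_eq_3)

lemma both_ends_pos: "2 \<le> k \<Longrightarrow> 2 * k \<le> m \<Longrightarrow> 0 < both_ends m k"
  by (simp add: both_ends_def fib_neq_0_nat)

text \<open>This is the addition formula at \<open>k - 2\<close> and \<open>m - k - 2\<close>. The
  last product measures the loss against the meta-position; it vanishes only for
  \<open>k = 2\<close> or \<open>k = m - 2\<close>.\<close>

lemma fib_eq_both_ends:
  assumes "2 \<le> k" "k + 2 \<le> m"
  shows "fib (m - 3) = both_ends m k + fib (k - 2) * fib (m - k - 2)"
proof -
  obtain x where x: "k = Suc (Suc x)" using assms by (metis add_2_eq_Suc le_Suc_ex)
  obtain y where y: "m - k = Suc (Suc y)" using assms by (metis add_2_eq_Suc le_Suc_ex le_diff_conv2 add_leD1 add.commute add_leD2)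
  have m: "m - 3 = Suc (x + y)" using x y assms by simp
  show ?thesis unfolding both_ends_def m y using fib_add[of x y] x by simp
qed

lemma both_ends_le:
  assumes "0 < k" "k < m"
  shows "both_ends m k \<le> fib (m - 3)"
proof (cases "2 \<le> k \<and> k + 2 \<le> m")
  case True
  then show ?thesis using fib_eq_both_ends[of k m] by simp
next
  case False
  then have "k = 1 \<or> m - k = 1" using assms by auto
  then show ?thesis by (auto simp: both_ends_def)
qed

text \<open>For \<open>k = 1\<close> the left side is zero and \<open>4 \<le> m\<close> makes the
  right side positive. For \<open>k \<ge> 3\<close> both factors of the loss term are positive,
  because \<open>2 * k \<le> m\<close> gives \<open>m - k \<ge> 3\<close>.\<close>

lemma both_ends_less:
  assumes "0 < k" "2 * k \<le> m" "k \<noteq> 2" "4 \<le> m"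
  shows "both_ends m k < fib (m - 3)"
proof (cases "k = 1")
  case True
  then show ?thesis using assms by (simp add: both_ends_def fib_neq_0_nat)
next
  case False
  then have "3 \<le> k" using assms by simp
  then show ?thesis using fib_eq_both_ends[of k m] assms by (simp add: fib_neq_0_nat)
qed

section \<open>Linearity and positivity of the matrix product\<close>

text \<open>Additivity and the scaling below allow a multiple of (1, -1) to be split off from the
  start vector.\<close>

lemma chain_sum_add: "chain_sum xs (p + p') (q + q') = chain_sum xs p q + chain_sum xs p' q'"
proof (induction xs arbitrary: p q p' q')
  case (Cons x xs)
  obtain m k where x: "x = (m, k)" by (cases x)
  show ?case
    unfolding x chain_sum.simps Cons.IH[symmetric] by (simp add: algebra_simps)
qed simp

lemma chain_sum_scale: "chain_sum xs (c * p) (c * q) = c * chain_sum xs p q"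
proof (induction xs arbitrary: p q)
  case (Cons x xs)
  obtain m k where x: "x = (m, k)" by (cases x)
  show ?case
    unfolding x chain_sum.simps Cons.IH[symmetric] by (simp add: algebra_simps)
qed (simp add: algebra_simps)

definition proper :: "nat \<times> nat \<Rightarrow> bool" where
  "proper x \<longleftrightarrow> 3 \<le> fst x \<and> 0 < snd x \<and> snd x < fst x"

text \<open>The matrix is split into ((\<open>fib m\<close>, \<open>fib (m - 1)\<close>),
  (\<open>fib (m - 1)\<close>, 0)) and \<open>both_ends m k\<close> times ((1, -1), (-1, 1)); the
  position acts only through the difference \<open>p - q\<close>.\<close>

lemma chain_sum_Cons:
  assumes "proper (m, k)"
  shows "chain_sum ((m, k) # xs) p q =
    chain_sum xs (p * int (fib m) + q * int (fib (m - 1)) + int (both_ends m k) * (p - q))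
      (p * int (fib (m - 1)) - int (both_ends m k) * (p - q))"
proof -
  have e: "int (fib (Suc k) * fib (Suc (m - k))) = int (fib m) + int (both_ends m k)"
    "int (fib k * fib (m - k)) = int (fib (m - 1)) - int (both_ends m k)"
    "int (fib (k - 1) * fib (m - k - 1)) = int (both_ends m k)"
    using transfer_entries[of k m] assms
    by (auto simp: proper_def both_ends_def simp flip: of_nat_add of_nat_mult)
  show ?thesis unfolding chain_sum.simps e by (simp add: algebra_simps)
qed

text \<open>The weak inequality \<open>q \<le> p\<close> becomes strict after one cycle. The start
  vector (1, 1) thus acquires the gap that every later comparison multiplies with.\<close>

lemma transfer_gap:
  assumes x: "proper (m, k)" and pq: "0 \<le> q" "q \<le> p" "0 < p"
  defines "p' \<equiv> p * int (fib m) + q * int (fib (m - 1)) + int (both_ends m k) * (p - q)"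
    and "q' \<equiv> p * int (fib (m - 1)) - int (both_ends m k) * (p - q)"
  shows "0 \<le> q'" "q' < p'"
proof -
  \<comment> \<open>With this \<open>i\<close> the bound \<open>fib (m - 3)\<close> on
    \<open>both_ends m k\<close> is \<open>fib i\<close>.\<close>
  obtain i where i: "m = i + 3" using x by (auto simp: proper_def le_iff_add add.commute)
  have le: "both_ends m k \<le> fib i"
    using both_ends_le[of k m] x by (simp add: proper_def i)
  have f: "fib (m - 1) = fib (Suc i) + fib i" "fib m = fib (m - 1) + fib (Suc i)"
    by (simp_all add: i numeral_3_eq_3)
  have mono: "fib i \<le> fib (Suc i)" by (rule fib_mono) simp
  have pos: "0 < fib (Suc i)" by (simp add: fib_neq_0_nat)
  have "int (both_ends m k) * (p - q) \<le> int (fib (m - 1)) * p"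
    using le pq f by (intro mult_mono) auto
  then show "0 \<le> q'" by (simp add: q'_def mult.commute)
  \<comment> \<open>It makes the coefficient of \<open>q\<close> in \<open>p' - q'\<close>
    nonnegative: \<open>both_ends m k\<close> is at most \<open>fib i\<close> and hence at most
    \<open>fib (Suc i)\<close>, and these two add up to \<open>fib (m - 1)\<close>.\<close>
  have "2 * int (both_ends m k) \<le> int (fib (m - 1))"
    using le mono f by simp
  then have "0 \<le> q * (int (fib (m - 1)) - 2 * int (both_ends m k))" using pq by simp
  moreover have "0 < p * (int (fib (Suc i)) + 2 * int (both_ends m k))" using pq pos by simp
  moreover have "p' - q' = p * (int (fib (Suc i)) + 2 * int (both_ends m k)) + q * (int (fib (m - 1)) - 2 * int (both_ends m k))"
    unfolding p'_def q'_def f(2) by (simp add: algebra_simps)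
  ultimately show "q' < p'" by linarith
qed

lemma chain_sum_pos:
  assumes "0 \<le> q" "0 < p"
  shows "0 < chain_sum xs p q"
  using assms
proof (induction xs arbitrary: p q)
  case (Cons x xs)
  obtain m k where x: "x = (m, k)" by (cases x)
  have "0 < int (fib (Suc k) * fib (Suc (m - k)))"
    by (simp add: fib_neq_0_nat del: fib.simps)
  then show ?case
    unfolding x chain_sum.simps using Cons.prems by (intro Cons.IH add_pos_nonneg add_nonneg_nonneg mult_pos_pos mult_nonneg_nonneg) auto
qed simp

text \<open>The vector \<open>(1, -1)\<close> spans the image of the difference of two transfer matrices of cycles of
  the same size.\<close>
lemma chain_sum_gap_pos:
  assumes "list_all proper xs" "xs \<noteq> []"
  shows "0 < chain_sum xs 1 (-1)"
proof -
  obtain m k ys where xs: "xs = (m, k) # ys" and x: "proper (m, k)" using assms by (cases xs) auto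
  obtain i where i: "m = i + 3" using x by (auto simp: proper_def le_iff_add add.commute)
  have le: "both_ends m k \<le> fib i"
    using both_ends_le[of k m] x by (simp add: proper_def i)
  have f: "fib (m - 1) = fib (Suc i) + fib i" "fib m = fib (m - 1) + fib (Suc i)"
    by (simp_all add: i numeral_3_eq_3)
  have "fib i \<le> fib (Suc i)" by (rule fib_mono) simp
  moreover have "0 < fib (Suc i)" by (simp add: fib_neq_0_nat)
  \<comment> \<open>With c for \<open>both_ends m k\<close>, one cycle sends (1, -1) to the vector
    with entries \<open>fib (Suc i)\<close> + 2c and \<open>fib (m - 1)\<close> - 2c, of which the
    first is positive and the second nonnegative. Without any cycle the sum would be zero.\<close>
  ultimately show ?thesis
    unfolding xs chain_sum_Cons[OF x] using le f by (intro chain_sum_pos) auto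
qed

text \<open>Exchanging the position adds a multiple of (1, -1) to the vector after the cycle, and
  linearity carries this multiple through the rest of the chain.\<close>

lemma chain_sum_Cons_diff:
  assumes "proper (m, k)" "proper (m, k')"
  shows "chain_sum ((m, k') # xs) p q - chain_sum ((m, k) # xs) p q =
    (int (both_ends m k') - int (both_ends m k)) * (p - q) * chain_sum xs 1 (-1)"
proof -
  define d where "d = (int (both_ends m k') - int (both_ends m k)) * (p - q)"
  have "chain_sum ((m, k') # xs) p q = chain_sum xs
    (p * int (fib m) + q * int (fib (m - 1)) + int (both_ends m k) * (p - q) + d * 1)
    (p * int (fib (m - 1)) - int (both_ends m k) * (p - q) + d * (-1))"
    unfolding chain_sum_Cons[OF assms(2)] d_def by (simp add: algebra_simps)
  also have "\<dots> = chain_sum ((m, k) # xs) p q + d * chain_sum xs 1 (-1)"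
    unfolding chain_sum_add chain_sum_scale chain_sum_Cons[OF assms(1)] ..
  finally show ?thesis by (simp add: d_def)
qed

section \<open>Comparison of chains position by position\<close>

text \<open>Values of \<open>both_ends\<close> are compared rather than positions, since
  \<open>both_ends m k\<close> is not monotone in \<open>k\<close>.\<close>

definition position_le :: "nat \<times> nat \<Rightarrow> nat \<times> nat \<Rightarrow> bool" where
  "position_le x y \<longleftrightarrow> proper x \<and> proper y \<and> fst x = fst y \<and>
     both_ends (fst x) (snd x) \<le> both_ends (fst y) (snd y)"

lemma chain_sum_Cons_gap:
  assumes "proper (m, k)" "0 \<le> q" "q \<le> p" "0 < p"
  obtains p' q' where "0 \<le> q'" "q' < p'" "\<And>xs. chain_sum ((m, k) # xs) p q = chain_sum xs p' q'"
  using transfer_gap[OF assms] chain_sum_Cons[OF assms(1)] by blast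

lemma list_all2_position_le_proper: "list_all2 position_le xs ys \<Longrightarrow> list_all proper ys"
  by (induction rule: list_all2_induct) (auto simp: position_le_def)

text \<open>The comparison passes through the list with the head of \<open>xs\<close> and the tail
  of \<open>ys\<close>: the tails are compared by induction from the vector behind the common head,
  the heads by their explicit difference.\<close>

lemma chain_sum_mono:
  assumes "list_all2 position_le xs ys" "0 \<le> q" "q < p"
  shows "chain_sum xs p q \<le> chain_sum ys p q"
  using assms
proof (induction xs ys arbitrary: p q rule: list_all2_induct)
  case (Cons x xs y ys)
  obtain m k k' where xy: "x = (m, k)" "y = (m, k')"
    using Cons.hyps by (cases x; cases y) (auto simp: position_le_def)
  then have x: "proper (m, k)" "proper (m, k')" "both_ends m k \<le> both_ends m k'"
    using Cons.hyps by (auto simp: position_le_def)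
  obtain p' q' where pq: "0 \<le> q'" "q' < p'" "\<And>xs. chain_sum ((m, k) # xs) p q = chain_sum xs p' q'"
    using chain_sum_Cons_gap[OF x(1) Cons.prems(1), of p] Cons.prems(2) le_less_trans[OF Cons.prems(1,2)]
    by (metis less_imp_le)
  have "chain_sum ((m, k) # xs) p q \<le> chain_sum ((m, k) # ys) p q"
    unfolding pq(3) using Cons.IH pq by simp
  \<comment> \<open>For empty \<open>ys\<close> the value is zero, so only the weak inequality holds
    here.\<close>
  moreover have "0 \<le> chain_sum ys 1 (-1)"
    using chain_sum_gap_pos[of ys] list_all2_position_le_proper[OF Cons.hyps(2)] by (cases ys) auto
  then have "0 \<le> chain_sum ((m, k') # ys) p q - chain_sum ((m, k) # ys) p q"
    unfolding chain_sum_Cons_diff[OF x(1,2)] using x(3) Cons.prems by (intro mult_nonneg_nonneg) auto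
  ultimately show ?case unfolding xy by linarith
qed simp

text \<open>The strict change must not be at the last index: its factor is the value of the
  remaining list at (1, -1), which is positive only for a nonempty list.\<close>

lemma chain_sum_strict_mono:
  assumes "list_all2 position_le xs ys" "0 \<le> q" "q < p"
    and "Suc i < length xs" "both_ends (fst (xs ! i)) (snd (xs ! i)) < both_ends (fst (ys ! i)) (snd (ys ! i))"
  shows "chain_sum xs p q < chain_sum ys p q"
  using assms
proof (induction xs ys arbitrary: p q i rule: list_all2_induct)
  case (Cons x xs y ys)
  obtain m k k' where xy: "x = (m, k)" "y = (m, k')"
    using Cons.hyps by (cases x; cases y) (auto simp: position_le_def)
  then have x: "proper (m, k)" "proper (m, k')" "both_ends m k \<le> both_ends m k'"
    using Cons.hyps by (auto simp: position_le_def)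
  obtain p' q' where pq: "0 \<le> q'" "q' < p'" "\<And>xs. chain_sum ((m, k) # xs) p q = chain_sum xs p' q'"
    using chain_sum_Cons_gap[OF x(1) Cons.prems(1), of p] Cons.prems(2) le_less_trans[OF Cons.prems(1,2)]
    by (metis less_imp_le)
  have ys: "ys \<noteq> []" using Cons.prems(3) list_all2_lengthD[OF Cons.hyps(2)] by auto
  have gap: "0 < chain_sum ys 1 (-1)"
    using chain_sum_gap_pos[OF list_all2_position_le_proper[OF Cons.hyps(2)] ys] .
  have diff: "0 \<le> chain_sum ((m, k') # ys) p q - chain_sum ((m, k) # ys) p q"
    unfolding chain_sum_Cons_diff[OF x(1,2)] using x(3) Cons.prems gap by (intro mult_nonneg_nonneg) auto
  have le: "chain_sum ((m, k) # xs) p q \<le> chain_sum ((m, k) # ys) p q"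
    unfolding pq(3) using chain_sum_mono[OF Cons.hyps(2)] pq by simp
  show ?case
  proof (cases i)
    case 0
    then have "0 < chain_sum ((m, k') # ys) p q - chain_sum ((m, k) # ys) p q"
      unfolding chain_sum_Cons_diff[OF x(1,2)] using Cons.prems gap xy by (intro mult_pos_pos) auto
    then show ?thesis using le unfolding xy by linarith
  next
    case (Suc j)
    then have "chain_sum ((m, k) # xs) p q < chain_sum ((m, k) # ys) p q"
      unfolding pq(3) using Cons.IH[of q' p' j] Cons.prems pq by auto
    then show ?thesis using diff unfolding xy by linarith
  qed
qed simp

text \<open>The vector (1, 1) has no gap, but the first cycle, which is the same on both sides,
  opens one. The strict comparison is then applied to the other cycles, where \<open>i\<close> has
  index \<open>i - 1\<close>.\<close>

lemma chain_sum_less: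
  assumes pos: "\<And>i. i < n \<Longrightarrow> position_le (m i, k i) (m i, k' i)"
    and eq: "k 0 = k' 0" and i: "0 < i" "Suc i < n" "both_ends (m i) (k i) < both_ends (m i) (k' i)"
  shows "chain_sum (map (\<lambda>i. (m i, k i)) [0..<n]) 1 1 < chain_sum (map (\<lambda>i. (m i, k' i)) [0..<n]) 1 1"
proof -
  have 0: "proper (m 0, k 0)" using pos[of 0] i by (simp add: position_le_def)
  obtain p q where pq: "0 \<le> q" "q < p" "\<And>xs. chain_sum ((m 0, k 0) # xs) 1 1 = chain_sum xs p q"
    using chain_sum_Cons_gap[OF 0, of 1 1] by (metis zero_le_one order_refl zero_less_one)
  have split: "map f [0..<n] = f 0 # map f [1..<n]" for f :: "nat \<Rightarrow> nat \<times> nat"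
    using i by (simp add: upt_conv_Cons)
  have "chain_sum (map (\<lambda>i. (m i, k i)) [1..<n]) p q < chain_sum (map (\<lambda>i. (m i, k' i)) [1..<n]) p q"
    using i pos pq(1,2)
    by (intro chain_sum_strict_mono[where i = "i - 1"]) (auto simp: list_all2_conv_all_nth)
  then show ?thesis
    unfolding split using pq(3) eq by simp
qed

section \<open>Cycles with two marked vertices\<close>

lemma cycle_graph_cyclic:
  assumes "cycle_graph C"
  obtains g where "cyclic (card (verts C)) g (verts C) (arcs_ends C)"
proof -
  interpret graph C using assms by (simp add: cycle_graph_def)
  obtain p u where p: "awalk u p u" "distinct (tl (awalk_verts u p))" "3 \<le> length p"
    and V: "verts C = tail C ` set p"
    and E: "arcs_ends C = arc_to_ends C ` set p \<union> (arc_to_ends C ` set p)\<inverse>"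
    using assms by (auto simp: cycle_graph_def cycle_def)
  define m where "m = length p"
  define vs where "vs = awalk_verts u p"
  define g where "g = (!) vs"
  have "p \<noteq> []" using p by auto
  \<comment> \<open>There is one vertex more than arcs, because the closed walk lists its start
    again at the end.\<close>
  have len: "length vs = Suc m" by (simp add: vs_def m_def length_awalk_verts)
  have t: "g i = tail C (p ! i)" if "i < m" for i
    using that \<open>p \<noteq> []\<close> by (simp add: g_def vs_def awalk_verts_conv nth_append m_def)
  have "cas u p u" using p(1) by (auto simp: awalk_def)
  then have h: "g (Suc i) = head C (p ! i)" if "i < m" for i
    using that \<open>p \<noteq> []\<close> by (simp add: g_def vs_def awalk_verts_conv' m_def)
  have "hd vs = u" "last vs = u" using p(1) by (auto simp: vs_def)
  then have gm: "g m = g 0"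
    using len by (metis One_nat_def diff_Suc_1 g_def hd_conv_nth last_conv_nth length_0_conv nat.distinct(1))
  have ne: "g i \<noteq> g j" if "0 < i" "i < j" "j \<le> m" for i j
  proof -
    have "tl vs ! (i - 1) \<noteq> tl vs ! (j - 1)"
      using p(2) that len unfolding vs_def[symmetric] by (subst nth_eq_iff_index_eq) auto
    then show ?thesis using that len by (simp add: nth_tl g_def)
  qed
  \<comment> \<open>Distinctness is known only for the tail of the vertex list, so index 0 is
    replaced by \<open>m\<close>.\<close>
  have "g i \<noteq> g j" if "i < j" "j < m" for i j
    using ne[of i j] ne[of j m] gm that by (cases "i = 0") auto
  then have inj: "inj_on g {..<m}" by (intro linorder_inj_onI) auto
  have set: "set p = (!) p ` {..<m}" by (auto simp: set_conv_nth m_def)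
  have V': "verts C = g ` {..<m}" unfolding V set image_image using t by auto
  have "arc_to_ends C (p ! i) = (g i, g (Suc i))" if "i < m" for i
    using t h that by (simp add: arc_to_ends_def)
  then have "arcs_ends C = walk_edges g 0 m"
    unfolding E set walk_edges_def image_image by auto
  then have "cyclic m g (verts C) (arcs_ends C)"
    using inj gm V' p(3) by (simp add: cyclic_def m_def)
  moreover have "card (verts C) = m" using V' inj by (simp add: card_image)
  ultimately show thesis using that by blast
qed

lemma cyclic_rotate:
  assumes c: "cyclic m g V E" and v: "v \<in> V"
  obtains g' where "cyclic m g' V E" "g' 0 = v"
proof -
  obtain r where r: "r < m" "g r = v" using c v by (auto simp: cyclic_def)
  have m: "3 \<le> m" "g m = g 0" and inj: "inj_on g {..<m}" and VE: "V = g ` {..<m}" "E = walk_edges g 0 m"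
    using c by (auto simp: cyclic_def)
  define h where "h i = (i + r) mod m" for i
  have h: "h i = (if i + r < m then i + r else i + r - m)" if "i < m" for i
    using that r by (auto simp: h_def le_mod_geq not_less)
  have injh: "inj_on h {..<m}"
    by (rule inj_onI) (auto simp: h split: if_splits)
  have hm: "h i < m" for i using m by (simp add: h_def)
  then have surj: "h ` {..<m} = {..<m}"
    using injh by (intro endo_inj_surj) auto
  \<comment> \<open>At the wrap-around \<open>Suc (h i) = m\<close>, where \<open>g m = g 0\<close>
    restores the equation.\<close>
  have suc: "g (h (Suc i)) = g (Suc (h i))" for i
  proof -
    have "h (Suc i) = Suc (h i) mod m" by (simp add: h_def mod_Suc_eq)
    moreover have "Suc (h i) = m \<or> Suc (h i) < m" using hm[of i] by linarith
    ultimately show ?thesis using m by auto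
  qed
  have "walk_edges (g \<circ> h) 0 m = (\<Union>i<m. {(g (h i), g (Suc (h i))), (g (Suc (h i)), g (h i))})"
    by (simp add: walk_edges_def suc atLeast0LessThan)
  also have "\<dots> = (\<Union>i\<in>h ` {..<m}. {(g i, g (Suc i)), (g (Suc i), g i)})" by simp
  also have "\<dots> = E" unfolding surj VE walk_edges_def by (simp add: atLeast0LessThan)
  finally have "walk_edges (g \<circ> h) 0 m = E" .
  moreover have "(g \<circ> h) ` {..<m} = V" unfolding VE image_comp[symmetric] surj ..
  moreover have "inj_on (g \<circ> h) {..<m}" using injh inj surj by (simp add: comp_inj_on)
  ultimately have "cyclic m (g \<circ> h) V E" using m by (auto simp: cyclic_def h_def)
  then show thesis using that r by (simp add: h_def)
qed

text \<open>Since \<open>g m = g 0\<close>, reflection keeps the start vertex; it moves the vertex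
  at index \<open>k\<close> to \<open>m - k\<close>.\<close>

lemma cyclic_reflect:
  assumes c: "cyclic m g V E"
  shows "cyclic m (\<lambda>i. g (m - i)) V E"
proof -
  have m: "3 \<le> m" "g m = g 0" and inj: "inj_on g {..<m}" and VE: "V = g ` {..<m}" "E = walk_edges g 0 m"
    using c by (auto simp: cyclic_def)
  have im: "(\<lambda>i. m - i) ` {..<m} = {0<..m}"
  proof
    show "{0<..m} \<subseteq> (\<lambda>i. m - i) ` {..<m}"
    proof
      fix x assume "x \<in> {0<..m}"
      then have "x = m - (m - x)" "m - x \<in> {..<m}" by auto
      then show "x \<in> (\<lambda>i. m - i) ` {..<m}" by (rule image_eqI)
    qed
  qed auto
  have "g ` {0<..m} = V"
  proof -
    have "insert 0 {0<..m} = insert m {..<m}" by auto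
    then have "insert (g 0) (g ` {0<..m}) = insert (g m) (g ` {..<m})" by (metis image_insert)
    moreover have "g 0 \<in> g ` {0<..m}" using m by (metis greaterThanAtMost_iff imageI order_refl zero_less_iff_neq_zero not_numeral_le_zero)
    ultimately show ?thesis using m VE by auto
  qed
  then have V: "(\<lambda>i. g (m - i)) ` {..<m} = V" using im by (metis image_image)
  have "card V = m" using VE inj by (simp add: card_image)
  \<comment> \<open>A map from \<open>m\<close> indices onto a set of \<open>m\<close> vertices is
    injective.\<close>
  then have inj': "inj_on (\<lambda>i. g (m - i)) {..<m}" by (intro eq_card_imp_inj_on) (simp_all add: V)
  have im': "(\<lambda>i. m - Suc i) ` {..<m} = {..<m}"
  proof
    show "{..<m} \<subseteq> (\<lambda>i. m - Suc i) ` {..<m}"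
    proof
      fix x assume "x \<in> {..<m}"
      then have "x = m - Suc (m - Suc x)" "m - Suc x \<in> {..<m}" by auto
      then show "x \<in> (\<lambda>i. m - Suc i) ` {..<m}" by (rule image_eqI)
    qed
  qed auto
  have "walk_edges (\<lambda>i. g (m - i)) 0 m =
      (\<Union>i<m. {(g (Suc (m - Suc i)), g (m - Suc i)), (g (m - Suc i), g (Suc (m - Suc i)))})"
    by (simp add: walk_edges_def Suc_diff_Suc atLeast0LessThan)
  also have "\<dots> = (\<Union>i\<in>(\<lambda>i. m - Suc i) ` {..<m}. {(g (Suc i), g i), (g i, g (Suc i))})" by simp
  also have "\<dots> = E" unfolding im' VE walk_edges_def by (simp add: atLeast0LessThan insert_commute)
  finally show ?thesis using V inj' m by (simp add: cyclic_def)
qed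

text \<open>Rotation puts \<open>v\<close> at index 0, and a reflection brings \<open>w\<close> into
  the first half if necessary.\<close>

lemma cyclic_two_poles:
  assumes c: "cyclic m g V E" and vw: "v \<in> V" "w \<in> V" "v \<noteq> w"
  obtains g' k where "cyclic m g' V E" "g' 0 = v" "g' k = w" "0 < k" "2 * k \<le> m"
proof -
  obtain g' where g': "cyclic m g' V E" "g' 0 = v" using cyclic_rotate[OF c vw(1)] .
  then obtain k where k: "k < m" "g' k = w" using vw by (auto simp: cyclic_def)
  have "0 < k" using k g' vw by (cases k) auto
  show thesis
  proof (cases "2 * k \<le> m")
    case True
    then show ?thesis using that g' k \<open>0 < k\<close> by blast
  next
    case False
    have "(\<lambda>i. g' (m - i)) 0 = v" using g' by (simp add: cyclic_def)
    moreover have "(\<lambda>i. g' (m - i)) (m - k) = w" "0 < m - k" "2 * (m - k) \<le> m"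
      using k False by auto
    ultimately show ?thesis using that cyclic_reflect[OF g'(1)] by blast
  qed
qed

lemma cyclic_adj:
  assumes c: "cyclic m g V E" and e: "(g i, g j) \<in> E" and ij: "i < m" "j < m"
  shows "j = Suc i \<or> i = Suc j \<or> i = 0 \<and> j = m - 1 \<or> j = 0 \<and> i = m - 1"
proof -
  have m: "g m = g 0" and inj: "inj_on g {..<m}" and E: "E = walk_edges g 0 m"
    using c by (auto simp: cyclic_def)
  have eq: "a = b" if "g a = g b" "a < m" "b < m" for a b
    using inj that by (auto dest: inj_onD)
  have suc: "b = Suc a \<or> b = 0 \<and> a = m - 1" if "g (Suc a) = g b" "a < m" "b < m" for a b
    using eq[of "Suc a" b] eq[of 0 b] that m by (cases "Suc a = m") auto
  obtain a where a: "a < m" "g a = g i \<and> g (Suc a) = g j \<or> g a = g j \<and> g (Suc a) = g i"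
    using e by (auto simp: E walk_edges_def)
  from a(2) show ?thesis
  proof
    assume "g a = g i \<and> g (Suc a) = g j"
    then show ?thesis using eq[of a i] suc[of a j] a ij by auto
  next
    assume "g a = g j \<and> g (Suc a) = g i"
    then show ?thesis using eq[of a j] suc[of a i] a ij by auto
  qed
qed

lemma cyclic_adj_one:
  assumes c: "cyclic m g V E" and k: "0 < k" "2 * k \<le> m" and e: "(g 0, g k) \<in> E"
  shows "k = 1"
  using cyclic_adj[OF c e] k by auto

text \<open>Neighbours of \<open>g 0\<close> have index 1 or \<open>m - 1\<close>, so
  \<open>k\<close> is 2 or \<open>m - 2\<close>. The latter together with
  \<open>2 * k \<le> m\<close> forces \<open>m \<le> 4\<close>, and nonadjacency excludes
  \<open>k = 1\<close>.\<close>

lemma cyclic_common_neighbour: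
  assumes c: "cyclic m g V E" and k: "0 < k" "2 * k \<le> m" and e: "(g 0, g k) \<notin> E"
    and w: "(g 0, w) \<in> E" "(w, g k) \<in> E"
  shows "k = 2"
proof -
  have m: "3 \<le> m" and V: "V = g ` {..<m}" and E: "E = walk_edges g 0 m" using c by (auto simp: cyclic_def)
  have "w \<in> V" using w cyclic_edges_sub[OF c] by auto
  then obtain j where j: "j < m" "w = g j" using V by auto
  have "k \<noteq> 1" using e m by (auto simp: E walk_edges_def)
  then show ?thesis
    using cyclic_adj[OF c, of 0 j] cyclic_adj[OF c, of j k] w j k by auto
qed

section \<open>Distances one and two\<close>

text \<open>The distance is an infimum over walks. Lengths are integers, so a walk of length less
  than \<open>k + 1\<close> attains it.\<close>

lemma dist_eq_walk:
  assumes "wf_digraph C" "wf_digraph.\<mu> C (\<lambda>_. 1) u v = ereal (real k)"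
  shows "\<exists>p. pre_digraph.awalk C u p v \<and> length p = k"
    and "pre_digraph.awalk C u p v \<Longrightarrow> k \<le> length p"
proof -
  interpret wf_digraph C by fact
  have cost: "awalk_cost (\<lambda>_. 1) p = real (length p)" for p :: "'b list"
    by (induction p) auto
  show le: "k \<le> length p" if "awalk u p v" for p
    using min_cost_le_walk_cost[OF that, of "\<lambda>_. 1"] assms(2) by (simp add: cost)
  have "(INF p\<in>{p. awalk u p v}. ereal (awalk_cost (\<lambda>_. 1) p)) < ereal (real k + 1)"
    using assms(2) by (simp add: \<mu>_def)
  then obtain p where p: "awalk u p v" "real (length p) < real k + 1"
    by (auto simp: INF_less_iff cost)
  then show "\<exists>p. awalk u p v \<and> length p = k" using le[OF p(1)] by (intro exI[of _ p]) auto
qed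

lemma dist_one_adj:
  assumes "wf_digraph C" "wf_digraph.\<mu> C (\<lambda>_. 1) u v = ereal (real 1)"
  shows "u \<rightarrow>\<^bsub>C\<^esub> v"
proof -
  interpret wf_digraph C by fact
  obtain e where "awalk u [e] v" using dist_eq_walk(1)[OF assms] by (auto simp: length_Suc_conv)
  then show ?thesis by (auto simp: awalk_def arcs_ends_conv)
qed

lemma dist_two_adj:
  assumes "wf_digraph C" "wf_digraph.\<mu> C (\<lambda>_. 1) u v = ereal (real 2)"
  shows "\<not> u \<rightarrow>\<^bsub>C\<^esub> v" "\<exists>w. u \<rightarrow>\<^bsub>C\<^esub> w \<and> w \<rightarrow>\<^bsub>C\<^esub> v"
proof -
  interpret wf_digraph C by fact
  obtain e e' where "awalk u [e, e'] v"
    using dist_eq_walk(1)[OF assms] by (auto simp: length_Suc_conv numeral_2_eq_2)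
  then have "e \<in> arcs C" "e' \<in> arcs C" "tail C e = u" "tail C e' = head C e" "head C e' = v"
    by (auto simp: awalk_def)
  then have "u \<rightarrow>\<^bsub>C\<^esub> head C e" "head C e \<rightarrow>\<^bsub>C\<^esub> v"
    using dominatesI[of e u "head C e"] dominatesI[of e' "head C e" v] by (simp_all add: arc_to_ends_def)
  then show "\<exists>w. u \<rightarrow>\<^bsub>C\<^esub> w \<and> w \<rightarrow>\<^bsub>C\<^esub> v" by blast
  show "\<not> u \<rightarrow>\<^bsub>C\<^esub> v"
  proof
    assume "u \<rightarrow>\<^bsub>C\<^esub> v"
    then obtain e where "e \<in> arcs C" "tail C e = u" "head C e = v" by auto
    then have "awalk u [e] v" by (auto simp: awalk_def)
    then show False using dist_eq_walk(2)[OF assms, of "[e]"] by simp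
  qed
qed

section \<open>Structure of chain cacti\<close>

lemma no_cut_vertex_small:
  assumes "wf_digraph H" "verts H \<subseteq> {a, b}"
  shows "\<not> cut_vertex H v"
proof
  interpret wf_digraph H by fact
  interpret D: wf_digraph "del_vert v" by (rule wf_digraph_del_vert)
  assume "cut_vertex H v"
  then obtain x y where "v \<in> verts H" "x \<in> verts H - {v}" "y \<in> verts H - {v}" "\<not> x \<rightarrow>\<^sup>*\<^bsub>del_vert v\<^esub> y"
    by (auto simp: cut_vertex_def)
  moreover from this have "x = y" using assms(2) by auto
  ultimately show False using D.reachable_refl[of x] by (auto simp: verts_del_vert)
qed

text \<open>In a finite graph some admissible subgraph containing \<open>H\<close> has the greatest
  total number of vertices and arcs, and it is a maximal one.\<close>

lemma block_extends:
  assumes "graph G" and H: "subgraph H G" "graph H" "connected H" "\<nexists>v. cut_vertex H v"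
  obtains B where "block G B" "subgraph H B"
proof -
  interpret graph G by fact
  define P where "P B \<longleftrightarrow> graph B \<and> connected B \<and> (\<nexists>v. cut_vertex B v)" for B :: "('a, 'b) pre_digraph"
  let ?Q = "\<lambda>B. P B \<and> subgraph H B \<and> subgraph B G"
  let ?f = "\<lambda>B. card (verts B) + card (arcs B)"
  have sub: "verts B \<subseteq> verts B' \<and> arcs B \<subseteq> arcs B' \<and> tail B' = tail B \<and> head B' = head B"
    if "subgraph B B'" for B B' :: "('a, 'b) pre_digraph"
    using that by (auto simp: subgraph_def compatible_def)
  have bound: "?f B < Suc (?f G)" if "subgraph B G" for B
    using sub[OF that] by (simp add: add_mono card_mono less_Suc_eq_le)
  have "?Q H" using H by (auto simp: P_def subgraph_def compatible_def)
  moreover have "\<forall>B. ?Q B \<longrightarrow> ?f B < Suc (?f G)" using bound by blast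
  ultimately obtain B where B: "?Q B" "\<And>B'. ?Q B' \<Longrightarrow> ?f B' \<le> ?f B"
    using ex_has_greatest_nat[of ?Q H ?f "Suc (?f G)"] by blast
  have "B' = B" if B': "subgraph B B'" "subgraph B' G" "P B'" for B'
  proof -
    have "subgraph H B'" using B(1) B'(1) subgraph_trans by blast
    then have le: "?f B' \<le> ?f B" using B' B(2) by blast
    have fin: "finite (verts B')" "finite (arcs B')"
      using sub[OF B'(2)] finite_subset[OF _ finite_verts] finite_subset[OF _ finite_arcs] by blast+
    have "card (verts B) \<le> card (verts B')" "card (arcs B) \<le> card (arcs B')"
      using sub[OF B'(1)] fin by (auto intro: card_mono)
    then have "card (verts B') \<le> card (verts B)" "card (arcs B') \<le> card (arcs B)"
      using le by linarith+
    then have "verts B = verts B'" "arcs B = arcs B'"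
      using sub[OF B'(1)] fin by (simp_all add: card_seteq)
    then show ?thesis using sub[OF B'(1)] by (intro pre_digraph.equality) auto
  qed
  then have "max_subgraph P B" using B(1) unfolding max_subgraph_def by blast
  then have "block G B" by (simp add: block_def P_def[abs_def])
  then show thesis using that B(1) by blast
qed

lemma block_through_vertex:
  assumes "graph G" "v \<in> verts G"
  obtains B where "block G B" "v \<in> verts B"
proof -
  interpret graph G by fact
  define H where "H = \<lparr>verts = {v}, arcs = {}, tail = tail G, head = head G\<rparr>"
  have H: "graph H"
    by unfold_locales (auto simp: H_def symmetric_def arcs_ends_def sym_def)
  then interpret H: graph H .
  have "subgraph H G"
    using assms(2) wf_digraph H.wf_digraph by (auto simp: subgraph_def compatible_def H_def)
  moreover have "connected H" by (auto simp: connected_conv) (auto simp: H_def)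
  moreover have "\<nexists>u. cut_vertex H u"
    using no_cut_vertex_small[OF H.wf_digraph, of v v] by (auto simp: H_def)
  ultimately obtain B where "block G B" "subgraph H B" using block_extends[OF assms(1) _ H] by blast
  then show thesis using that by (auto simp: subgraph_def H_def)
qed

text \<open>An arc together with its reverse is a connected graph without cut vertices, hence
  extends to a block.\<close>

lemma block_through_arc:
  assumes "graph G" "e \<in> arcs G"
  obtains B where "block G B" "e \<in> arcs B"
proof -
  interpret graph G by fact
  obtain e' where e': "e' \<in> arcs G" "tail G e' = head G e" "head G e' = tail G e"
    using sym_arcs assms(2) unfolding symmetric_conv by metis
  define H where "H = \<lparr>verts = {tail G e, head G e}, arcs = {e, e'}, tail = tail G, head = head G\<rparr>"
  have H: "graph H"
    using assms(2) e' no_loops no_multi_arcs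
    by unfold_locales (auto simp: H_def symmetric_conv arc_to_ends_def)
  then interpret H: graph H .
  have "subgraph H G"
    using assms(2) e' wf_digraph H.wf_digraph by (auto simp: subgraph_def compatible_def H_def)
  moreover have "connected H"
  proof -
    have "(u, v) \<in> rtrancl_on (verts H) (symcl (arcs_ends H))" if "u \<in> verts H" "v \<in> verts H" for u v
    proof (cases "u = v")
      case False
      then have "(u, v) \<in> symcl (arcs_ends H)"
        using that e' by (auto simp: H_def symcl_def arcs_ends_conv)
      then show ?thesis using that rtrancl_on_into_rtrancl_on[of u u] by auto
    qed (use that in auto)
    then show ?thesis by (auto simp: connected_conv) (auto simp: H_def)
  qed
  moreover have "\<nexists>u. cut_vertex H u"
    using no_cut_vertex_small[OF H.wf_digraph, of "tail G e" "head G e"] by (auto simp: H_def)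
  ultimately obtain B where "block G B" "subgraph H B" using block_extends[OF assms(1) _ H] by blast
  then show thesis using that by (auto simp: subgraph_def H_def)
qed

lemma block_in_cycles:
  assumes "chain_cactus G" "block G B"
  shows "B \<in> cycles G"
  using assms by (auto simp: chain_cactus_def cycles_def block_def pre_digraph.max_subgraph_def)

lemma chain_cactus_graph: "chain_cactus G \<Longrightarrow> graph G"
  by (simp add: chain_cactus_def cactus_def)

text \<open>Every vertex lies in some block, and the blocks of a chain cactus are cycles.\<close>

lemma chain_cactus_verts:
  assumes "chain_cactus G"
  shows "verts G = (\<Union>C\<in>cycles G. verts C)"
proof
  show "verts G \<subseteq> (\<Union>C\<in>cycles G. verts C)"
  proof
    fix x assume "x \<in> verts G"
    then obtain B where "block G B" "x \<in> verts B"
      using block_through_vertex[OF chain_cactus_graph[OF assms]] by metis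
    then show "x \<in> (\<Union>C\<in>cycles G. verts C)" using block_in_cycles[OF assms] by blast
  qed
  show "(\<Union>C\<in>cycles G. verts C) \<subseteq> verts G"
    by (rule UN_least) (simp add: cycles_def subgraph_def)
qed

lemma chain_cactus_arcs_ends:
  assumes "chain_cactus G"
  shows "arcs_ends G = (\<Union>C\<in>cycles G. arcs_ends C)"
proof
  show "(\<Union>C\<in>cycles G. arcs_ends C) \<subseteq> arcs_ends G"
    by (intro UN_least arcs_ends_mono) (simp add: cycles_def)
  show "arcs_ends G \<subseteq> (\<Union>C\<in>cycles G. arcs_ends C)"
  proof
    fix x assume "x \<in> arcs_ends G"
    then obtain e where e: "e \<in> arcs G" "x = (tail G e, head G e)" by (auto simp: arcs_ends_conv)
    then obtain B where B: "B \<in> cycles G" "e \<in> arcs B"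
      using block_through_arc[OF chain_cactus_graph[OF assms]] block_in_cycles[OF assms] by metis
    then have "tail B = tail G" "head B = head G"
      by (auto simp: cycles_def subgraph_def compatible_def)
    then have "x \<in> arcs_ends B" using e B by (auto simp: arcs_ends_conv)
    then show "x \<in> (\<Union>C\<in>cycles G. arcs_ends C)" using B by blast
  qed
qed

text \<open>A block through an arc of \<open>C\<close> is itself a cycle, and in a cactus two cycles
  with a common arc coincide.\<close>

lemma chain_cactus_cycle_block:
  assumes "chain_cactus G" "C \<in> cycles G"
  shows "block G C"
proof -
  have C: "subgraph C G" "cycle_graph C" using assms by (auto simp: cycles_def)
  then obtain p where p: "length p \<ge> 3" "arcs_ends C = arc_to_ends C ` set p \<union> (arc_to_ends C ` set p)\<inverse>"
    by (auto simp: cycle_graph_def)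
  then have "set p \<noteq> {}" by auto
  then have "arcs_ends C \<noteq> {}" using p(2) by auto
  then obtain e where e: "e \<in> arcs C" by (auto simp: arcs_ends_def)
  then have "e \<in> arcs G" using C by (auto simp: subgraph_def)
  then obtain B where B: "block G B" "e \<in> arcs B"
    using block_through_arc[OF chain_cactus_graph[OF assms(1)]] by metis
  have "C = B"
    using assms block_in_cycles[OF assms(1) B(1)] B(2) e \<open>e \<in> arcs G\<close>
    unfolding chain_cactus_def cactus_def by blast
  then show ?thesis using B by simp
qed

section \<open>Cut vertices and the order of the cycles\<close>

text \<open>For \<open>S = verts G\<close> this contradicts that \<open>w\<close> is a cut
  vertex.\<close>

definition linked_off :: "('a, 'b) pre_digraph \<Rightarrow> 'a \<Rightarrow> 'a set \<Rightarrow> bool" where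
  "linked_off G w S \<longleftrightarrow> (\<forall>x\<in>S - {w}. \<forall>y\<in>S - {w}. x \<rightarrow>\<^sup>*\<^bsub>pre_digraph.del_vert G w\<^esub> y)"

lemma linked_off_Un:
  assumes "wf_digraph G" "linked_off G w S" "linked_off G w T" "z \<in> S \<inter> T" "z \<noteq> w"
  shows "linked_off G w (S \<union> T)"
proof -
  interpret wf_digraph G by fact
  interpret D: wf_digraph "del_vert w" by (rule wf_digraph_del_vert)
  have "x \<rightarrow>\<^sup>*\<^bsub>del_vert w\<^esub> z \<and> z \<rightarrow>\<^sup>*\<^bsub>del_vert w\<^esub> x" if "x \<in> S \<union> T - {w}" for x
    using that assms(2-5) by (auto simp: linked_off_def)
  then show ?thesis
    unfolding linked_off_def by (meson D.reachable_trans)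
qed

text \<open>If \<open>w\<close> lies on \<open>C\<close>, the rest of \<open>C\<close> stays
  connected because the block \<open>C\<close> has no cut vertex; otherwise \<open>C\<close>
  survives the deletion of \<open>w\<close> unchanged.\<close>

lemma linked_off_cycle:
  assumes "chain_cactus G" "C \<in> cycles G"
  shows "linked_off G w (verts C)"
proof -
  have b: "block G C" using chain_cactus_cycle_block[OF assms] .
  then have C: "subgraph C G" "graph C" "connected C" "\<not> cut_vertex C w"
    by (auto simp: block_def pre_digraph.max_subgraph_def)
  interpret C: graph C by fact
  interpret G: graph G using chain_cactus_graph assms by blast
  interpret D: wf_digraph "G.del_vert w" by (rule G.wf_digraph_del_vert)
  have "strongly_connected C" using C C.symmetric_connected_imp_strongly_connected C.sym_arcs by blast
  then have sc: "x \<rightarrow>\<^sup>*\<^bsub>C\<^esub> y" if "x \<in> verts C" "y \<in> verts C" for x y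
    using that by (auto simp: strongly_connected_def)
  have e: "tail G = tail C" "head G = head C" "verts C \<subseteq> verts G" "arcs C \<subseteq> arcs G"
    using C(1) by (auto simp: subgraph_def compatible_def)
  show ?thesis
  proof (cases "w \<in> verts C")
    case True
    have "subgraph (C.del_vert w) (G.del_vert w)"
      using e C.wf_digraph_del_vert D.wf_digraph
      by (auto simp: subgraph_def compatible_def C.del_vert_simps G.del_vert_simps)
    moreover have "x \<rightarrow>\<^sup>*\<^bsub>C.del_vert w\<^esub> y" if "x \<in> verts C - {w}" "y \<in> verts C - {w}" for x y
      using that sc C(4) True by (auto simp: cut_vertex_def)
    ultimately show ?thesis
      unfolding linked_off_def by (intro ballI) (rule pre_digraph.reachable_mono)
  next
    case False
    then have "tail C a \<noteq> w \<and> head C a \<noteq> w" if "a \<in> arcs C" for a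
      using that C.wellformed by metis
    then have "subgraph C (G.del_vert w)"
      using False e C.wf_digraph D.wf_digraph
      by (auto simp: subgraph_def compatible_def C.del_vert_simps G.del_vert_simps)
    then show ?thesis
      unfolding linked_off_def by (intro ballI) (rule pre_digraph.reachable_mono[OF sc], auto)
  qed
qed

lemma linked_off_segment:
  assumes "wf_digraph G" "a \<le> b" "\<And>i. a \<le> i \<Longrightarrow> i \<le> b \<Longrightarrow> linked_off G w (V i)"
    and "\<And>i. a \<le> i \<Longrightarrow> i < b \<Longrightarrow> \<exists>z \<in> V i \<inter> V (Suc i). z \<noteq> w"
  shows "linked_off G w (\<Union>i\<in>{a..b}. V i)"
  using assms(2-)
proof (induction b rule: dec_induct)
  case (step b)
  then obtain z where "z \<in> V b \<inter> V (Suc b)" "z \<noteq> w" by (meson le_refl lessI)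
  moreover have "linked_off G w (\<Union>i\<in>{a..b}. V i)" using step by auto
  moreover have "linked_off G w (V (Suc b))" using step by auto
  ultimately have "linked_off G w ((\<Union>i\<in>{a..b}. V i) \<union> V (Suc b))"
    using step(1) by (intro linked_off_Un[OF assms(1), of w _ _ z]) auto
  moreover have "(\<Union>i\<in>{a..Suc b}. V i) = (\<Union>i\<in>{a..b}. V i) \<union> V (Suc b)"
    using step(1) by (auto simp: atLeastAtMostSuc_conv)
  ultimately show ?case by simp
qed simp

lemma chain_structure:
  assumes G: "chain_cactus G" and Cs: "chain_order G Cs"
  obtains v where
    "\<And>i. Suc i < length Cs \<Longrightarrow> cut_vertex G (v i) \<and> verts (Cs ! i) \<inter> verts (Cs ! Suc i) = {v i}"
    "\<And>i j. i < j \<Longrightarrow> j < length Cs \<Longrightarrow> j \<noteq> Suc i \<Longrightarrow> verts (Cs ! i) \<inter> verts (Cs ! j) = {}"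
    "\<And>i. Suc (Suc i) < length Cs \<Longrightarrow> v i \<noteq> v (Suc i)"
proof -
  define V where "V i = verts (Cs ! i)" for i
  define n where "n = length Cs"
  have Cs': "distinct Cs" "set Cs = cycles G"
    "\<forall>i. \<exists>v. Suc i < n \<longrightarrow> cut_vertex G v \<and> V i \<inter> V (Suc i) = {v}"
    using Cs by (auto simp: chain_order_def V_def n_def)
  from choice[OF Cs'(3)] obtain v where
    v': "\<forall>i. Suc i < n \<longrightarrow> cut_vertex G (v i) \<and> V i \<inter> V (Suc i) = {v i}" ..
  then have v: "cut_vertex G (v i)" "V i \<inter> V (Suc i) = {v i}" if "Suc i < n" for i
    using that by simp_all
  interpret graph G using chain_cactus_graph[OF G] .
  have cyc: "Cs ! i \<in> cycles G" if "i < n" for i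
    using nth_mem[of i Cs] that unfolding n_def Cs'(2) .
  \<comment> \<open>Equal joints would put three different cycles through one cut vertex, which lies
    in exactly two.\<close>
  have vne: "v i \<noteq> v j" if "i < j" "Suc j < n" for i j
  proof
    assume eq: "v i = v j"
    let ?S = "{C \<in> cycles G. v i \<in> verts C}"
    have "v i \<in> V i \<inter> V (Suc i)" "v j \<in> V j \<inter> V (Suc j)" using v that by auto
    then have sub: "{Cs ! i, Cs ! Suc i, Cs ! Suc j} \<subseteq> ?S" using eq cyc that by (auto simp: V_def)
    have S: "card ?S = 2" using G v that by (auto simp: chain_cactus_def)
    then have "finite ?S" by (intro card_ge_0_finite) simp
    from card_mono[OF this sub] have "card {Cs ! i, Cs ! Suc i, Cs ! Suc j} \<le> 2" unfolding S .
    moreover have "Cs ! i \<noteq> Cs ! Suc i" "Cs ! i \<noteq> Cs ! Suc j" "Cs ! Suc i \<noteq> Cs ! Suc j"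
      using Cs'(1) that by (simp_all add: nth_eq_iff_index_eq n_def)
    ultimately show False by simp
  qed
  \<comment> \<open>If cycles on both sides of \<open>v i\<close> shared another vertex
    \<open>x\<close>, the two halves of the chain would be linked through \<open>x\<close> after
    deletion of \<open>v i\<close>, which is a cut vertex.\<close>
  have sep: "V a \<inter> V b \<subseteq> {v i}" if "a \<le> i" "i < b" "b < n" for a b i
  proof
    fix x assume x: "x \<in> V a \<inter> V b"
    show "x \<in> {v i}"
    proof (rule ccontr)
      assume ne: "x \<notin> {v i}"
      let ?L = "\<Union>j\<in>{0..i}. V j" and ?R = "\<Union>j\<in>{Suc i..n - 1}. V j"
      have link: "linked_off G (v i) (V j)" if "j < n" for j
        unfolding V_def using linked_off_cycle[OF G cyc[OF that]] .
      \<comment> \<open>Inside each half consecutive cycles are joined at some \<open>v j\<close>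
        different from \<open>v i\<close>.\<close>
      have joint: "\<exists>z \<in> V j \<inter> V (Suc j). z \<noteq> v i" if "Suc j < n" "j \<noteq> i" for j
      proof (intro bexI)
        show "v j \<noteq> v i" using vne[of i j] vne[of j i] that \<open>i < b\<close> \<open>b < n\<close> by (cases "i < j") auto
        show "v j \<in> V j \<inter> V (Suc j)" using v(2) that by simp
      qed
      have "linked_off G (v i) ?L"
        using \<open>i < b\<close> \<open>b < n\<close> by (intro linked_off_segment[OF wf_digraph] link joint) auto
      moreover have "linked_off G (v i) ?R"
        using \<open>i < b\<close> \<open>b < n\<close> by (intro linked_off_segment[OF wf_digraph] link joint) auto
      moreover have "x \<in> ?L \<inter> ?R" using x that by auto
      ultimately have "linked_off G (v i) (?L \<union> ?R)"
        using ne by (intro linked_off_Un[OF wf_digraph]) auto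
      moreover have "?L \<union> ?R = verts G"
      proof -
        have "{0..i} \<union> {Suc i..n - 1} = {..<n}" using that by auto
        then have "?L \<union> ?R = (\<Union>j<n. V j)" by (metis UN_Un)
        also have "\<dots> = (\<Union>C\<in>set Cs. verts C)"
          by (auto simp: V_def n_def set_conv_nth)
        finally show ?thesis using chain_cactus_verts[OF G] Cs'(2) by simp
      qed
      ultimately show False
        using v(1)[of i] that by (auto simp: linked_off_def cut_vertex_def)
    qed
  qed
  show thesis
  proof
    show "cut_vertex G (v i) \<and> verts (Cs ! i) \<inter> verts (Cs ! Suc i) = {v i}" if "Suc i < length Cs" for i
      using v that by (auto simp: n_def V_def)
    show "v i \<noteq> v (Suc i)" if "Suc (Suc i) < length Cs" for i
      using vne that by (auto simp: n_def)
    show "verts (Cs ! i) \<inter> verts (Cs ! j) = {}" if "i < j" "j < length Cs" "j \<noteq> Suc i" for i j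
    proof -
      \<comment> \<open>Between nonconsecutive cycles there are two different joints, each of which
        would have to be the only common vertex.\<close>
      have "V i \<inter> V j \<subseteq> {v i}" "V i \<inter> V j \<subseteq> {v (Suc i)}"
        using sep[of i i j] sep[of i "Suc i" j] that by (auto simp: n_def)
      moreover have "v i \<noteq> v (Suc i)" using vne[of i "Suc i"] that by (auto simp: n_def)
      ultimately show ?thesis unfolding V_def by blast
    qed
  qed
qed

lemma chain_internal_cut_vertices:
  assumes G: "chain_cactus G" and C: "C \<in> cycles G"
    and v: "cut_vertex G v" "cut_vertex G w" "v \<in> verts C" "w \<in> verts C" "v \<noteq> w"
  shows "{u \<in> verts C. cut_vertex G u} = {v, w}"
proof -
  interpret C: graph C using C by (simp add: cycles_def cycle_graph_def)
  have "card {u \<in> verts C. cut_vertex G u} \<le> 2"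
    using G chain_cactus_cycle_block[OF G C] by (simp add: chain_cactus_def)
  then have "card {u \<in> verts C. cut_vertex G u} \<le> card {v, w}" using v(5) by simp
  moreover have "{v, w} \<subseteq> {u \<in> verts C. cut_vertex G u}" using v by simp
  ultimately show ?thesis using card_seteq[of "{u \<in> verts C. cut_vertex G u}" "{v, w}"] by simp
qed

text \<open>An end cycle has a free pole, which is taken adjacent to the other pole; so
  \<open>k = 1\<close> at the ends of every chain. The poles of an internal cycle are its two cut
  vertices, and \<open>k\<close> is the length of a shorter way between them.\<close>

lemma chain_decomposition:
  assumes G: "chain_cactus G" and Cs: "chain_order G Cs" and n: "card (cycles G) = n"
    and m: "\<forall>i<n. card (verts (Cs ! i)) = m i"
  obtains g k where
    "cycle_chain n m k g (\<lambda>i. verts (Cs ! i)) (\<lambda>i. arcs_ends (Cs ! i))"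
    "verts G = (\<Union>i<n. verts (Cs ! i))" "arcs_ends G = (\<Union>i<n. arcs_ends (Cs ! i))" "0 < n"
    "\<And>i. i < n \<Longrightarrow> 2 * k i \<le> m i" "k 0 = 1" "k (n - 1) = 1"
    "\<And>i. 0 < i \<Longrightarrow> Suc i < n \<Longrightarrow> in_position 1 G (Cs ! i) \<Longrightarrow> k i = 1"
    "\<And>i. 0 < i \<Longrightarrow> Suc i < n \<Longrightarrow> in_position 2 G (Cs ! i) \<Longrightarrow> k i = 2"
proof -
  define V where "V i = verts (Cs ! i)" for i
  define E where "E i = arcs_ends (Cs ! i)" for i
  have Cs': "distinct Cs" "cycles G = set Cs" using Cs by (simp_all add: chain_order_def)
  have len: "length Cs = n" using n distinct_card[OF Cs'(1)] Cs'(2) by simp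
  have set: "cycles G = (\<lambda>i. Cs ! i) ` {..<n}"
    unfolding Cs'(2) len[symmetric] by (auto simp: set_conv_nth)
  have cyc: "Cs ! i \<in> cycles G" if "i < n" for i using that set by simp
  have VG: "verts G = (\<Union>i<n. V i)" and EG: "arcs_ends G = (\<Union>i<n. E i)"
    using chain_cactus_verts[OF G] chain_cactus_arcs_ends[OF G] by (simp_all add: set V_def E_def)
  have "connected G" using G by (simp add: chain_cactus_def cactus_def)
  then have "verts G \<noteq> {}" by (simp add: connected_conv)
  then have "0 < n" using VG by auto
  obtain v where v:
    "\<And>i. Suc i < n \<Longrightarrow> cut_vertex G (v i) \<and> V i \<inter> V (Suc i) = {v i}"
    "\<And>i j. i < j \<Longrightarrow> j < n \<Longrightarrow> j \<noteq> Suc i \<Longrightarrow> V i \<inter> V j = {}"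
    "\<And>i. Suc (Suc i) < n \<Longrightarrow> v i \<noteq> v (Suc i)"
    using chain_structure[OF G Cs] unfolding len V_def by metis
  have in1: "v i \<in> V i" and in2: "v i \<in> V (Suc i)" if "Suc i < n" for i
    using v(1)[OF that] by auto
  let ?pos = "\<lambda>i g k. cyclic (m i) g (V i) (E i) \<and> 0 < k \<and> 2 * k \<le> m i \<and>
    (0 < i \<longrightarrow> g 0 = v (i - 1)) \<and> (Suc i < n \<longrightarrow> g k = v i) \<and> (i = 0 \<or> Suc i = n \<longrightarrow> k = 1) \<and>
    (0 < i \<and> Suc i < n \<longrightarrow> (in_position 1 G (Cs ! i) \<longrightarrow> k = 1) \<and> (in_position 2 G (Cs ! i) \<longrightarrow> k = 2))"
  have "\<exists>g k. ?pos i g k" if i: "i < n" for i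
  proof -
    have "cycle_graph (Cs ! i)" using cyc[OF i] by (simp add: cycles_def)
    then interpret C: graph "Cs ! i" by (simp add: cycle_graph_def)
    obtain g where g: "cyclic (m i) g (V i) (E i)"
      using cycle_graph_cyclic[OF \<open>cycle_graph (Cs ! i)\<close>] m i unfolding V_def E_def by metis
    have m3: "3 \<le> m i" using g by (simp add: cyclic_def)
    consider "i = 0" | "0 < i" "Suc i = n" | "0 < i" "Suc i < n" using i by linarith
    then show ?thesis
    proof cases
      case 1
      \<comment> \<open>A chain with a single cycle has no joint, and then any vertex serves as
        \<open>w\<close>.\<close>
      have "g 0 \<in> V i" using g by (auto simp: cyclic_def)
      then obtain w where w: "w \<in> V i" "Suc i < n \<longrightarrow> w = v i" using in1 by blast
      obtain h where h: "cyclic (m i) h (V i) (E i)" "h 0 = w" using cyclic_rotate[OF g w(1)] .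
      have h1: "h 1 \<in> V i" "h 1 \<noteq> w" "(h 1, w) \<in> E i"
        using h m3 by (auto simp: cyclic_def walk_edges_def dest!: inj_onD[of h _ 1 0])
      \<comment> \<open>The joint has to be the second pole, so the enumeration starts at its
        neighbour \<open>h 1\<close>.\<close>
      obtain g' k where g': "cyclic (m i) g' (V i) (E i)" "g' 0 = h 1" "g' k = w" "0 < k" "2 * k \<le> m i"
        using cyclic_two_poles[OF g h1(1) w(1) h1(2)] .
      then have "k = 1" using cyclic_adj_one[OF g'(1)] h1(3) by simp
      then show ?thesis using g' w 1 by auto
    next
      case 2
      then have "v (i - 1) \<in> V i" using in2[of "i - 1"] by simp
      then obtain g' where "cyclic (m i) g' (V i) (E i)" "g' 0 = v (i - 1)" using cyclic_rotate[OF g] by metis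
      then show ?thesis using 2 m3 by (intro exI[of _ g'] exI[of _ 1]) auto
    next
      case 3
      let ?u = "v (i - 1)"
      have uv: "?u \<in> V i" "v i \<in> V i" "?u \<noteq> v i" "cut_vertex G ?u" "cut_vertex G (v i)"
        using in2[of "i - 1"] in1[of i] v(3)[of "i - 1"] v(1)[of "i - 1"] v(1)[of i] 3 by auto
      obtain g' k where g': "cyclic (m i) g' (V i) (E i)" "g' 0 = ?u" "g' k = v i" "0 < k" "2 * k \<le> m i"
        using cyclic_two_poles[OF g uv(1-3)] .
      have cut: "{w \<in> verts (Cs ! i). cut_vertex G w} = {?u, v i}"
        using chain_internal_cut_vertices[OF G cyc[OF i] uv(4,5)] uv(1-3) by (simp add: V_def)
      have symE: "(b, a) \<in> E i" if "(a, b) \<in> E i" for a b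
        using that C.graph_symmetric by (simp add: E_def)
      have "k = 1" if pos: "in_position 1 G (Cs ! i)"
      proof -
        \<comment> \<open>The position names the cut vertices only as an unordered pair; symmetry of
          the edges covers both orders.\<close>
        obtain a b where ab: "{a, b} = {?u, v i}" "(a, b) \<in> E i"
          using pos dist_one_adj[OF C.wf_digraph] unfolding in_position_def cut E_def by metis
        then have "(?u, v i) \<in> E i" using symE by (auto simp: doubleton_eq_iff)
        then show ?thesis using cyclic_adj_one[OF g'(1)] g' by simp
      qed
      moreover have "k = 2" if pos: "in_position 2 G (Cs ! i)"
      proof -
        obtain a b w where ab: "{a, b} = {?u, v i}" "(a, b) \<notin> E i" "(a, w) \<in> E i" "(w, b) \<in> E i"
          using pos dist_two_adj[OF C.wf_digraph] unfolding in_position_def cut E_def by metis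
        then have "(?u, v i) \<notin> E i" "(?u, w) \<in> E i" "(w, v i) \<in> E i"
          using symE by (auto simp: doubleton_eq_iff)
        then show ?thesis using cyclic_common_neighbour[OF g'(1), of k w] g' by simp
      qed
      ultimately show ?thesis using g' 3 by auto
    qed
  qed
  then have "\<forall>i. \<exists>gk. i < n \<longrightarrow> ?pos i (fst gk) (snd gk)" by auto
  from choice[OF this] obtain gk where gk: "\<forall>i. i < n \<longrightarrow> ?pos i (fst (gk i)) (snd (gk i))" ..
  define g where "g i = fst (gk i)" for i
  define k where "k i = snd (gk i)" for i
  have pos: "?pos i (g i) (k i)" if "i < n" for i
    using gk that unfolding g_def k_def by blast
  have "k i < m i" if "i < n" for i using pos[OF that] by (auto simp: cyclic_def)
  moreover have "V i \<inter> V j = (if j = Suc i then {g j 0} else {})" if "i < j" "j < n" for i j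
    using v(1)[of i] v(2)[OF that] pos[OF that(2)] that by auto
  moreover have "g i (k i) = g (Suc i) 0" if "Suc i < n" for i
    using pos[of i] pos[OF that] that by auto
  ultimately have "cycle_chain n m k g V E"
    using pos unfolding cycle_chain_def by blast
  moreover have "k 0 = 1" "k (n - 1) = 1" using pos[of 0] pos[of "n - 1"] \<open>0 < n\<close> by auto
  moreover have "2 * k i \<le> m i" if "i < n" for i using pos[OF that] by blast
  moreover have "in_position 1 G (Cs ! i) \<Longrightarrow> k i = 1" "in_position 2 G (Cs ! i) \<Longrightarrow> k i = 2"
    if "0 < i" "Suc i < n" for i
    using pos[of i] that by auto
  ultimately show thesis
    using that[of k g] VG EG \<open>0 < n\<close> unfolding V_def[abs_def] E_def[abs_def] by blast
qed

section \<open>Isomorphism of chains with equal positions\<close>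

text \<open>A vertex of two cycles is their joint, with index \<open>k i\<close> in the earlier
  cycle and 0 in the later one. Equal positions give the same coincidence in the other
  chain.\<close>

lemma cycle_chain_same_vertex:
  assumes c: "cycle_chain n m k g V E" and c': "cycle_chain n m k' g' V' E'"
    and k: "\<forall>i<n. k i = k' i"
    and ij: "i < n" "j < n" "a < m i" "b < m j" "g i a = g j b"
  shows "g' i a = g' j b"
  using ij
proof (induction i j arbitrary: a b rule: linorder_wlog)
  case (le i j)
  have V: "V l = g l ` {..<m l}" "inj_on (g l) {..<m l}" if "l < n" for l
    using c that by (auto simp: cycle_chain_def cyclic_def)
  show ?case
  proof (cases "i = j")
    case True
    then show ?thesis using V(2)[of j] le by (auto dest: inj_onD)
  next
    case False
    then have "i < j" using le by simp
    then have "V i \<inter> V j = (if j = Suc i then {g j 0} else {})"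
      using c le unfolding cycle_chain_def by blast
    moreover have "g i a \<in> V i" "g i a \<in> V j"
      using V(1)[of i] V(1)[of j] le.prems by (metis imageI lessThan_iff)+
    ultimately have j: "j = Suc i" "g i a = g j 0" by (auto split: if_splits)
    then have joint: "g i (k i) = g j 0" "g' i (k' i) = g' j 0" "k i < m i" "0 < m j"
      using c c' le unfolding cycle_chain_def by auto
    have "a = k i" using inj_onD[OF V(2), of i a "k i"] le joint j by auto
    moreover have "b = 0" using inj_onD[OF V(2), of j b 0] le joint j by auto
    ultimately show ?thesis using joint k le by simp
  qed
next
  case (sym i j)
  then show ?case by metis
qed

text \<open>The map sends \<open>g i a\<close> to \<open>g' i a\<close>. It is well defined because
  coincidences carry over from the first chain to the second, and injective because they also carry
  over backwards.\<close>

lemma cycle_chain_iso: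
  assumes c: "cycle_chain n m k g V E" and c': "cycle_chain n m k' g' V' E'"
    and k: "\<forall>i<n. k i = k' i"
  obtains \<phi> where "inj_on \<phi> (\<Union>i<n. V i)" "\<phi> ` (\<Union>i<n. V i) = (\<Union>i<n. V' i)"
    "map_prod \<phi> \<phi> ` (\<Union>i<n. E i) = (\<Union>i<n. E' i)"
proof -
  have cyc: "V i = g i ` {..<m i}" "g i (m i) = g i 0" "E i = walk_edges (g i) 0 (m i)"
    "V' i = g' i ` {..<m i}" "g' i (m i) = g' i 0" "E' i = walk_edges (g' i) 0 (m i)" "0 < m i" if "i < n" for i
    using c c' that unfolding cycle_chain_def cyclic_def by auto
  define \<phi> where "\<phi> x = (THE y. \<exists>i<n. \<exists>a<m i. x = g i a \<and> y = g' i a)" for x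
  have \<phi>: "\<phi> (g i a) = g' i a" if "i < n" "a < m i" for i a
    unfolding \<phi>_def
  proof (rule the_equality)
    show "\<exists>j<n. \<exists>b<m j. g i a = g j b \<and> g' i a = g' j b" using that by blast
    fix y assume "\<exists>j<n. \<exists>b<m j. g i a = g j b \<and> y = g' j b"
    then obtain j b where "j < n" "b < m j" "g i a = g j b" "y = g' j b" by blast
    then show "y = g' i a"
      using cycle_chain_same_vertex[OF c c' k that(1) _ that(2), of j b] by simp
  qed
  have \<phi>': "\<phi> (g i a) = g' i a" if "i < n" "a \<le> m i" for i a
    using \<phi>[of i a] \<phi>[of i 0] cyc[OF that(1)] that by (cases "a = m i") auto
  have k': "\<forall>i<n. k' i = k i" using k by simp
  show thesis
  proof
    show "inj_on \<phi> (\<Union>i<n. V i)"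
    proof (rule inj_onI)
      fix x y assume "x \<in> (\<Union>i<n. V i)" "y \<in> (\<Union>i<n. V i)" and eq: "\<phi> x = \<phi> y"
      then obtain i a j b where ij: "i < n" "x = g i a" "a < m i" "j < n" "y = g j b" "b < m j"
        using cyc(1) by auto
      then show "x = y" using cycle_chain_same_vertex[OF c' c k', of i j a b] eq \<phi> by simp
    qed
    have "\<phi> ` V i = V' i" if "i < n" for i
      using \<phi>[OF that] cyc(1,4)[OF that] by (simp add: image_image)
    then show "\<phi> ` (\<Union>i<n. V i) = (\<Union>i<n. V' i)" by (simp add: image_UN)
    have "map_prod \<phi> \<phi> ` E i = E' i" if "i < n" for i
      unfolding cyc(3)[OF that] cyc(6)[OF that] walk_edges_def image_UN
      using \<phi>'[OF that] by (intro SUP_cong) simp_all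
    then show "map_prod \<phi> \<phi> ` (\<Union>i<n. E i) = (\<Union>i<n. E' i)" by (simp add: image_UN)
  qed
qed

text \<open>Without parallel arcs an arc is determined by its ends, so the vertex map induces the
  arc map.\<close>

lemma digraph_isoI:
  assumes "graph G" "graph H" and \<phi>: "inj_on \<phi> (verts G)" "\<phi> ` verts G = verts H"
    "map_prod \<phi> \<phi> ` arcs_ends G = arcs_ends H"
  shows "digraph_iso G H"
proof -
  interpret G: graph G by fact
  interpret H: graph H by fact
  define \<psi> where "\<psi> = inv_into (arcs H) (arc_to_ends H) \<circ> map_prod \<phi> \<phi> \<circ> arc_to_ends G"
  define f where "f = \<lparr>iso_verts = \<phi>, iso_arcs = \<psi>, iso_head = head H, iso_tail = tail H\<rparr>"
  have img: "map_prod \<phi> \<phi> ` arc_to_ends G ` arcs G = arc_to_ends H ` arcs H"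
    using \<phi>(3) by (simp add: arcs_ends_def)
  have ends: "arc_to_ends H (\<psi> e) = map_prod \<phi> \<phi> (arc_to_ends G e)" if "e \<in> arcs G" for e
    unfolding \<psi>_def comp_def using that img by (intro f_inv_into_f) blast
  have "inj_on (map_prod \<phi> \<phi>) (arc_to_ends G ` arcs G)"
    by (rule inj_on_subset[OF map_prod_inj_on[OF \<phi>(1) \<phi>(1)]]) (auto simp: arc_to_ends_def)
  then have "inj_on \<psi> (arcs G)"
    unfolding \<psi>_def using G.inj_on_arc_to_ends img
    by (intro comp_inj_on inj_on_inv_into) (auto simp: image_comp)
  moreover have "\<psi> ` arcs G = arcs H"
    unfolding \<psi>_def image_comp[symmetric] img
    by (rule inv_into_image_cancel) (auto simp: H.inj_on_arc_to_ends)
  ultimately have "G.digraph_isomorphism f" "H = app_iso f G"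
    using ends \<phi>(1,2) G.wf_digraph
    by (auto simp: G.digraph_isomorphism_def f_def arc_to_ends_def app_iso_def)
  then show ?thesis unfolding digraph_iso_def by blast
qed

lemma chain_cactus_iso:
  assumes "chain_cactus G" "chain_cactus H"
    and "cycle_chain n m k g V E" "verts G = (\<Union>i<n. V i)" "arcs_ends G = (\<Union>i<n. E i)"
    and "cycle_chain n m k' h W F" "verts H = (\<Union>i<n. W i)" "arcs_ends H = (\<Union>i<n. F i)"
    and "\<forall>i<n. k i = k' i"
  shows "digraph_iso G H"
proof -
  obtain \<phi> where "inj_on \<phi> (\<Union>i<n. V i)" "\<phi> ` (\<Union>i<n. V i) = (\<Union>i<n. W i)"
    "map_prod \<phi> \<phi> ` (\<Union>i<n. E i) = (\<Union>i<n. F i)"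
    using cycle_chain_iso[OF assms(3,6,9)] .
  then show ?thesis
    by (intro digraph_isoI[where \<phi> = \<phi>] chain_cactus_graph assms(1,2)) (simp_all only: assms(4,5,7,8))
qed

section \<open>The two inequalities\<close>

lemma num_indep_sets_cycle_chain:
  assumes "cycle_chain n m k g V E" "0 < n" "verts G = (\<Union>i<n. V i)" "arcs_ends G = (\<Union>i<n. E i)"
  shows "int (num_indep_sets G) = chain_sum (map (\<lambda>i. (m i, k i)) [0..<n]) 1 1"
  using card_indep_cycle_chain[OF assms(1,2)]
  by (simp add: num_indep_sets_def indep_sets_eq assms(3,4))

lemma cycle_chain_proper: "cycle_chain n m k g V E \<Longrightarrow> i < n \<Longrightarrow> proper (m i, k i)"
  by (simp add: cycle_chain_def cyclic_def proper_def)

theorem theorem13: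
  fixes A\<^sub>n :: "('a, 'b) pre_digraph" and As :: "('a, 'b) pre_digraph list"
    and O\<^sub>n :: "('c, 'd) pre_digraph" and Os :: "('c, 'd) pre_digraph list"
    and M\<^sub>n :: "('e, 'f) pre_digraph" and Ms :: "('e, 'f) pre_digraph list"
    and n :: nat
  assumes "chain_cactus A\<^sub>n" and "chain_order A\<^sub>n As" and "card (cycles A\<^sub>n) = n"
    and "ortho_chain O\<^sub>n Os" and "card (cycles O\<^sub>n) = n"
    and "meta_chain M\<^sub>n Ms" and "card (cycles M\<^sub>n) = n"
    and "\<forall>i<n. card (verts (Os ! i)) = card (verts (As ! i))"
    and "\<forall>i<n. card (verts (Ms ! i)) = card (verts (As ! i))"
    and "\<not> digraph_iso A\<^sub>n O\<^sub>n" and "\<not> digraph_iso A\<^sub>n M\<^sub>n"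
  shows "num_indep_sets O\<^sub>n < num_indep_sets A\<^sub>n \<and> num_indep_sets A\<^sub>n < num_indep_sets M\<^sub>n"
proof -
  define m where "m i = card (verts (As ! i))" for i
  have O: "chain_cactus O\<^sub>n" "chain_order O\<^sub>n Os" "internal_in_position 1 O\<^sub>n Os"
    and M: "chain_cactus M\<^sub>n" "chain_order M\<^sub>n Ms" "internal_in_position 2 M\<^sub>n Ms"
    using assms(4,6) by (simp_all add: ortho_chain_def meta_chain_def)
  have mA: "\<forall>i<n. card (verts (As ! i)) = m i" and mO: "\<forall>i<n. card (verts (Os ! i)) = m i"
    and mM: "\<forall>i<n. card (verts (Ms ! i)) = m i"
    using assms(8,9) by (simp_all add: m_def)
  obtain g k where A: "cycle_chain n m k g (\<lambda>i. verts (As ! i)) (\<lambda>i. arcs_ends (As ! i))"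
    "verts A\<^sub>n = (\<Union>i<n. verts (As ! i))" "arcs_ends A\<^sub>n = (\<Union>i<n. arcs_ends (As ! i))" "0 < n"
    and kA: "\<And>i. i < n \<Longrightarrow> 2 * k i \<le> m i" "k 0 = 1" "k (n - 1) = 1"
    by (rule chain_decomposition[OF assms(1-3) mA]; rule that)
  obtain gO kO where O': "cycle_chain n m kO gO (\<lambda>i. verts (Os ! i)) (\<lambda>i. arcs_ends (Os ! i))"
    "verts O\<^sub>n = (\<Union>i<n. verts (Os ! i))" "arcs_ends O\<^sub>n = (\<Union>i<n. arcs_ends (Os ! i))"
    and kO: "kO 0 = 1" "kO (n - 1) = 1"
      "\<And>i. 0 < i \<Longrightarrow> Suc i < n \<Longrightarrow> in_position 1 O\<^sub>n (Os ! i) \<Longrightarrow> kO i = 1"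
    by (rule chain_decomposition[OF O(1,2) assms(5) mO]; rule that)
  obtain gM kM where M': "cycle_chain n m kM gM (\<lambda>i. verts (Ms ! i)) (\<lambda>i. arcs_ends (Ms ! i))"
    "verts M\<^sub>n = (\<Union>i<n. verts (Ms ! i))" "arcs_ends M\<^sub>n = (\<Union>i<n. arcs_ends (Ms ! i))"
    and kM: "\<And>i. i < n \<Longrightarrow> 2 * kM i \<le> m i" "kM 0 = 1" "kM (n - 1) = 1"
      "\<And>i. 0 < i \<Longrightarrow> Suc i < n \<Longrightarrow> in_position 2 M\<^sub>n (Ms ! i) \<Longrightarrow> kM i = 2"
    by (rule chain_decomposition[OF M(1,2) assms(7) mM]; rule that)
  have "length Os = n" "length Ms = n"
    using O(2) M(2) assms(5,7) distinct_card unfolding chain_order_def by metis+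
  then have intO: "kO i = 1" and intM: "kM i = 2" if "0 < i" "Suc i < n" for i
    using O(3) M(3) kO(3) kM(4) that by (simp_all add: internal_in_position_def)
  \<comment> \<open>All three chains have position 1 at both ends, so they can differ only at
    internal cycles.\<close>
  have ends: "k i = 1 \<and> kO i = 1 \<and> kM i = 1" if "i < n" "\<not> (0 < i \<and> Suc i < n)" for i
  proof -
    have "i = 0 \<or> i = n - 1" using that by linarith
    then show ?thesis using kA kO kM by blast
  qed
  have k0: "0 < k i" "k i < m i" if "i < n" for i
    using A(1) that by (simp_all add: cycle_chain_def)
  have num: "int (num_indep_sets A\<^sub>n) = chain_sum (map (\<lambda>i. (m i, k i)) [0..<n]) 1 1"
    "int (num_indep_sets O\<^sub>n) = chain_sum (map (\<lambda>i. (m i, kO i)) [0..<n]) 1 1"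
    "int (num_indep_sets M\<^sub>n) = chain_sum (map (\<lambda>i. (m i, kM i)) [0..<n]) 1 1"
    using num_indep_sets_cycle_chain[OF A(1,4,2,3)] num_indep_sets_cycle_chain[OF O'(1) A(4) O'(2,3)]
      num_indep_sets_cycle_chain[OF M'(1) A(4) M'(2,3)] .
  have "num_indep_sets O\<^sub>n < num_indep_sets A\<^sub>n"
  proof -
    \<comment> \<open>Equal positions throughout would make the two chains isomorphic.\<close>
    obtain i where i: "i < n" "k i \<noteq> kO i"
      using chain_cactus_iso[OF assms(1) O(1) A(1-3) O'] assms(10) by blast
    then have int: "0 < i" "Suc i < n" using ends by metis+
    have "both_ends (m i) (kO i) < both_ends (m i) (k i)"
      using both_ends_pos[of "k i" "m i"] kA(1)[OF i(1)] k0[OF i(1)] i(2)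
      unfolding intO[OF int] both_ends_one by simp
    moreover have "position_le (m j, kO j) (m j, k j)" if "j < n" for j
    proof -
      have "kO j = 1" using intO[of j] ends[OF that] by blast
      then show ?thesis
        using cycle_chain_proper[OF A(1) that] cycle_chain_proper[OF O'(1) that] both_ends_one[of "m j"]
        by (simp add: position_le_def)
    qed
    ultimately have "int (num_indep_sets O\<^sub>n) < int (num_indep_sets A\<^sub>n)"
      unfolding num using kA(2) kO(1) int by (intro chain_sum_less[where i = i]) simp_all
    then show ?thesis by simp
  qed
  moreover have "num_indep_sets A\<^sub>n < num_indep_sets M\<^sub>n"
  proof -
    obtain i where i: "i < n" "k i \<noteq> kM i"
      using chain_cactus_iso[OF assms(1) M(1) A(1-3) M'] assms(11) by blast
    then have int: "0 < i" "Suc i < n" using ends by metis+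
    \<comment> \<open>The condition \<open>4 \<le> m i\<close> comes from the meta-chain, whose
      position 2 at this cycle is at most half of \<open>m i\<close>.\<close>
    have "both_ends (m i) (k i) < both_ends (m i) (kM i)"
      using both_ends_less[OF k0(1)[OF i(1)] kA(1)[OF i(1)]] kM(1)[OF i(1)] i(2)
      unfolding intM[OF int] both_ends_two by simp
    moreover have "position_le (m j, k j) (m j, kM j)" if "j < n" for j
    proof -
      have "both_ends (m j) (k j) \<le> both_ends (m j) (kM j)"
      proof (cases "0 < j \<and> Suc j < n")
        case True
        then show ?thesis using both_ends_le[OF k0[OF that]] intM[of j] both_ends_two[of "m j"] by simp
      next
        case False
        then show ?thesis using ends[OF that] by simp
      qed
      then show ?thesis
        using cycle_chain_proper[OF A(1) that] cycle_chain_proper[OF M'(1) that] by (simp add: position_le_def)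
    qed
    ultimately have "int (num_indep_sets A\<^sub>n) < int (num_indep_sets M\<^sub>n)"
      unfolding num using kA(2) kM(2) int by (intro chain_sum_less[where i = i]) simp_all
    then show ?thesis by simp
  qed
  ultimately show ?thesis by blast
qed

end
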